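(* Let $H_1,H_2\in(0,1)\setminus\{\frac12\}$, $H=H_1+H_2\in(0,2)$, $H\ne1$, let $Y=(Y^1,Y^2)$ be the bivariate fractional Ornstein–Uhlenbeck process, fix an integer $s\ge1$ and let $\hat\rho_n,\hat\eta_{12,n}$ be the estimators defined in the context. Then, as $n\to+\infty$, $\hat\rho_n\to\rho$ and $\hat\eta_{12,n}\to\eta_{12}$ in $L^2(\mathbb P)$, and hence in probability.
   Context: Bivariate fractional Brownian motion ($H=H_1+H_2\ne1$). $(B^{H_1}_t,B^{H_2}_t)_{t\in\mathbb R}$ is a centered Gaussian process such that each $B^{H_i}$ is a fractional Brownian motion on $\mathbb R$ with Hurst index $H_i$, $\mathrm{Var}(B^{H_i}_1)=1$, and for $i\ne j$ $$\mathbb E[B^{H_i}_tB^{H_j}_s]=\tfrac12\big((\rho+\mathrm{sign}(t)\eta_{ij})|t|^H+(\rho-\mathrm{sign}(s)\eta_{ij})|s|^H-(\rho-\mathrm{sign}(s-t)\eta_{ij})|s-t|^H\big),$$ with $\mathrm{sign}(x)=1$ for $x\ge0$, $-1$ for $x<0$; $\rho\in[-1,1]$ and $\eta_{12}=-\eta_{21}\in\mathbb R$ are such that this is a valid covariance. Bivariate fractional Ornstein–Uhlenbeck process: $Y^i_t=\nu_i\int_{-\infty}^te^{-\alpha_i(t-u)}dB^{H_i}_u$, $t\in\mathbb R$, $i=1,2$ (pathwise Riemann–Stieltjes integrals), with $\alpha_i,\nu_i>0$. Estimators (the marginal parameters $\alpha_i,\nu_i,H_i$ are known). For $s\in\mathbb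 N$, $s\ge1$, put $I_{ij}(s)=\int_0^se^{\alpha_iu}\big(\int_{-\infty}^0e^{\alpha_jv}(u-v)^{H-2}dv\big)du$ and $$a_1(s)=-\frac{I_{12}(s)+I_{21}(s)}{\nu_1\nu_2H(H-1)I_{12}(s)I_{21}(s)},\quad a_2(s)=\frac{e^{\alpha_1s}}{\nu_1\nu_2H(H-1)I_{12}(s)},\quad a_3(s)=\frac{e^{\alpha_2s}}{\nu_1\nu_2H(H-1)I_{21}(s)},$$ $$b_1(s)=\frac{I_{12}(s)-I_{21}(s)}{\nu_1\nu_2H(H-1)I_{12}(s)I_{21}(s)},\quad b_2(s)=a_2(s),\quad b_3(s)=-a_3(s).$$ Then $$\hat\rho_n=\frac{a_1(s)}n\sum_{j=1}^nY^1_jY^2_j+\frac{a_2(s)}n\sum_{j=1}^{n-s}Y^1_{j+s}Y^2_j+\frac{a_3(s)}n\sum_{j=1}^{n-s}Y^1_jY^2_{j+s},$$ $$\hat\eta_{12,n}=\frac{b_1(s)}n\sum_{j=1}^nY^1_jY^2_j+\frac{b_2(s)}n\sum_{j=1}^{n-s}Y^1_{j+s}Y^2_j+\frac{b_3(s)}n\sum_{j=1}^{n-s}Y^1_jY^2_{j+s}.$$ *)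

theory Defs
  imports "HOL-Probability.Probability"
begin

subsection \<open>Gaussian processes and fractional Brownian motion\<close>

text \<open>Point masses at 0 count as Gaussian: linear combinations may be degenerate.\<close>

definition centered_gaussian :: "'a measure \<Rightarrow> ('a \<Rightarrow> real) \<Rightarrow> bool" where
  "centered_gaussian M X \<longleftrightarrow>
     X \<in> borel_measurable M \<and>
     ((AE \<omega> in M. X \<omega> = 0) \<or>
      (\<exists>\<sigma>>0. distributed M lborel X (\<lambda>x. ennreal (normal_density 0 \<sigma> x))))"

definition centered_gaussian_process ::
  "'a measure \<Rightarrow> 'i set \<Rightarrow> ('i \<Rightarrow> 'a \<Rightarrow> real) \<Rightarrow> bool" where
  "centered_gaussian_process M I X \<longleftrightarrow>
     (\<forall>J c. finite J \<longrightarrow> J \<subseteq> I \<longrightarrow> centered_gaussian M (\<lambda>\<omega>. \<Sum>i\<in>J. c i * X i \<omega>))"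

definition fractional_brownian_motion ::
  "'a measure \<Rightarrow> real \<Rightarrow> (real \<Rightarrow> 'a \<Rightarrow> real) \<Rightarrow> bool" where
  "fractional_brownian_motion M h X \<longleftrightarrow>
     centered_gaussian_process M UNIV X \<and>
     (\<forall>t s. (\<integral>\<omega>. X t \<omega> * X s \<omega> \<partial>M) =
        prob_space.variance M (X 1) / 2 *
          (\<bar>t\<bar> powr (2 * h) + \<bar>s\<bar> powr (2 * h) - \<bar>s - t\<bar> powr (2 * h))) \<and>
     (AE \<omega> in M. continuous_on UNIV (\<lambda>t. X t \<omega>))"

text \<open>Unlike \<^const>\<open>sgn\<close>, this takes the value 1 at 0.\<close>

definition sign_rc :: "real \<Rightarrow> real" where
  "sign_rc x = (if x \<ge> 0 then 1 else -1)"

text \<open>Components and Hurst indices are indexed by the numbers 1 and 2; values at other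
  indices are irrelevant.\<close>

definition bivariate_fbm ::
  "'a measure \<Rightarrow> (nat \<Rightarrow> real) \<Rightarrow> real \<Rightarrow> (nat \<Rightarrow> nat \<Rightarrow> real) \<Rightarrow>
     (nat \<Rightarrow> real \<Rightarrow> 'a \<Rightarrow> real) \<Rightarrow> bool" where
  "bivariate_fbm M h \<rho> \<eta> B \<longleftrightarrow>
     \<rho> \<in> {-1..1} \<and> \<eta> 1 2 = - \<eta> 2 1 \<and>
     centered_gaussian_process M ({1, 2} \<times> UNIV) (\<lambda>(i, t). B i t) \<and>
     (\<forall>i\<in>{1, 2}. fractional_brownian_motion M (h i) (B i) \<and>
        prob_space.variance M (B i 1) = 1) \<and>
     (\<forall>i\<in>{1, 2}. \<forall>j\<in>{1, 2}. i \<noteq> j \<longrightarrow> (\<forall>t s.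
        (\<integral>\<omega>. B i t \<omega> * B j s \<omega> \<partial>M) =
          1 / 2 * ((\<rho> + sign_rc t * \<eta> i j) * \<bar>t\<bar> powr (h 1 + h 2)
                 + (\<rho> - sign_rc s * \<eta> i j) * \<bar>s\<bar> powr (h 1 + h 2)
                 - (\<rho> - sign_rc (s - t) * \<eta> i j) * \<bar>s - t\<bar> powr (h 1 + h 2))))"

subsection \<open>Riemann--Stieltjes integrals and the Ornstein--Uhlenbeck process\<close>

text \<open>The integral of f against dg over [a, b], as a limit of tagged sums when the mesh tends
  to 0 (the gauge is a constant radius, not a general one).\<close>

definition has_rs_integral ::
  "(real \<Rightarrow> real) \<Rightarrow> (real \<Rightarrow> real) \<Rightarrow> real \<Rightarrow> real \<Rightarrow> real \<Rightarrow> bool" where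
  "has_rs_integral f g a b I \<longleftrightarrow>
     (\<forall>\<epsilon>>0. \<exists>\<delta>>0. \<forall>p. p tagged_division_of {a..b} \<longrightarrow> (\<lambda>x. ball x \<delta>) fine p \<longrightarrow>
        \<bar>(\<Sum>(x, k)\<in>p. f x * (g (Sup k) - g (Inf k))) - I\<bar> < \<epsilon>)"

definition has_rs_integral_atMost ::
  "(real \<Rightarrow> real) \<Rightarrow> (real \<Rightarrow> real) \<Rightarrow> real \<Rightarrow> real \<Rightarrow> bool" where
  "has_rs_integral_atMost f g b I \<longleftrightarrow>
     (\<exists>J. (\<forall>a<b. has_rs_integral f g a b (J a)) \<and> (J \<longlongrightarrow> I) at_bot)"

definition bivariate_fou ::
  "'a measure \<Rightarrow> (nat \<Rightarrow> real) \<Rightarrow> (nat \<Rightarrow> real) \<Rightarrow> (nat \<Rightarrow> real \<Rightarrow> 'a \<Rightarrow> real) \<Rightarrow>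
     (nat \<Rightarrow> real \<Rightarrow> 'a \<Rightarrow> real) \<Rightarrow> bool" where
  "bivariate_fou M \<alpha> \<nu> B Y \<longleftrightarrow>
     (\<forall>i\<in>{1, 2}.
        (\<forall>t. Y i t \<in> borel_measurable M) \<and>
        (AE \<omega> in M. \<forall>t. \<exists>I.
           has_rs_integral_atMost (\<lambda>u. exp (- \<alpha> i * (t - u))) (\<lambda>u. B i u \<omega>) t I \<and>
           Y i t \<omega> = \<nu> i * I))"

subsection \<open>The estimators\<close>

definition I_coef :: "real \<Rightarrow> (nat \<Rightarrow> real) \<Rightarrow> nat \<Rightarrow> nat \<Rightarrow> nat \<Rightarrow> real" where
  "I_coef H \<alpha> i j s =
     (LINT u:{0..real s}|lborel. exp (\<alpha> i * u) *
        (LINT v:{..0}|lborel. exp (\<alpha> j * v) * (u - v) powr (H - 2)))"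

definition a1 :: "real \<Rightarrow> (nat \<Rightarrow> real) \<Rightarrow> (nat \<Rightarrow> real) \<Rightarrow> nat \<Rightarrow> real" where
  "a1 H \<alpha> \<nu> s = - (I_coef H \<alpha> 1 2 s + I_coef H \<alpha> 2 1 s) /
     (\<nu> 1 * \<nu> 2 * H * (H - 1) * I_coef H \<alpha> 1 2 s * I_coef H \<alpha> 2 1 s)"

definition a2 :: "real \<Rightarrow> (nat \<Rightarrow> real) \<Rightarrow> (nat \<Rightarrow> real) \<Rightarrow> nat \<Rightarrow> real" where
  "a2 H \<alpha> \<nu> s = exp (\<alpha> 1 * real s) / (\<nu> 1 * \<nu> 2 * H * (H - 1) * I_coef H \<alpha> 1 2 s)"

definition a3 :: "real \<Rightarrow> (nat \<Rightarrow> real) \<Rightarrow> (nat \<Rightarrow> real) \<Rightarrow> nat \<Rightarrow> real" where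
  "a3 H \<alpha> \<nu> s = exp (\<alpha> 2 * real s) / (\<nu> 1 * \<nu> 2 * H * (H - 1) * I_coef H \<alpha> 2 1 s)"

definition b1 :: "real \<Rightarrow> (nat \<Rightarrow> real) \<Rightarrow> (nat \<Rightarrow> real) \<Rightarrow> nat \<Rightarrow> real" where
  "b1 H \<alpha> \<nu> s = (I_coef H \<alpha> 1 2 s - I_coef H \<alpha> 2 1 s) /
     (\<nu> 1 * \<nu> 2 * H * (H - 1) * I_coef H \<alpha> 1 2 s * I_coef H \<alpha> 2 1 s)"

definition b2 :: "real \<Rightarrow> (nat \<Rightarrow> real) \<Rightarrow> (nat \<Rightarrow> real) \<Rightarrow> nat \<Rightarrow> real" where
  "b2 H \<alpha> \<nu> s = a2 H \<alpha> \<nu> s"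

definition b3 :: "real \<Rightarrow> (nat \<Rightarrow> real) \<Rightarrow> (nat \<Rightarrow> real) \<Rightarrow> nat \<Rightarrow> real" where
  "b3 H \<alpha> \<nu> s = - a3 H \<alpha> \<nu> s"

text \<open>For \<open>n \<le> s\<close> the lagged sums below are empty, as natural subtraction truncates.\<close>

definition rho_hat ::
  "real \<Rightarrow> (nat \<Rightarrow> real) \<Rightarrow> (nat \<Rightarrow> real) \<Rightarrow> nat \<Rightarrow> (nat \<Rightarrow> real \<Rightarrow> 'a \<Rightarrow> real) \<Rightarrow>
     nat \<Rightarrow> 'a \<Rightarrow> real" where
  "rho_hat H \<alpha> \<nu> s Y n \<omega> =
     a1 H \<alpha> \<nu> s / real n * (\<Sum>j=1..n. Y 1 (real j) \<omega> * Y 2 (real j) \<omega>)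
   + a2 H \<alpha> \<nu> s / real n * (\<Sum>j=1..n - s. Y 1 (real (j + s)) \<omega> * Y 2 (real j) \<omega>)
   + a3 H \<alpha> \<nu> s / real n * (\<Sum>j=1..n - s. Y 1 (real j) \<omega> * Y 2 (real (j + s)) \<omega>)"

definition eta_hat ::
  "real \<Rightarrow> (nat \<Rightarrow> real) \<Rightarrow> (nat \<Rightarrow> real) \<Rightarrow> nat \<Rightarrow> (nat \<Rightarrow> real \<Rightarrow> 'a \<Rightarrow> real) \<Rightarrow>
     nat \<Rightarrow> 'a \<Rightarrow> real" where
  "eta_hat H \<alpha> \<nu> s Y n \<omega> =
     b1 H \<alpha> \<nu> s / real n * (\<Sum>j=1..n. Y 1 (real j) \<omega> * Y 2 (real j) \<omega>)
   + b2 H \<alpha> \<nu> s / real n * (\<Sum>j=1..n - s. Y 1 (real (j + s)) \<omega> * Y 2 (real j) \<omega>)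
   + b3 H \<alpha> \<nu> s / real n * (\<Sum>j=1..n - s. Y 1 (real j) \<omega> * Y 2 (real (j + s)) \<omega>)"

subsection \<open>Modes of convergence\<close>

definition converges_L2 ::
  "'a measure \<Rightarrow> (nat \<Rightarrow> 'a \<Rightarrow> real) \<Rightarrow> ('a \<Rightarrow> real) \<Rightarrow> bool" where
  "converges_L2 M X Z \<longleftrightarrow>
     Z \<in> borel_measurable M \<and> integrable M (\<lambda>\<omega>. (Z \<omega>)\<^sup>2) \<and>
     (\<forall>n. X n \<in> borel_measurable M \<and> integrable M (\<lambda>\<omega>. (X n \<omega>)\<^sup>2)) \<and>
     (\<lambda>n. \<integral>\<omega>. (X n \<omega> - Z \<omega>)\<^sup>2 \<partial>M) \<longlonglongrightarrow> 0"

definition converges_in_prob ::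
  "'a measure \<Rightarrow> (nat \<Rightarrow> 'a \<Rightarrow> real) \<Rightarrow> ('a \<Rightarrow> real) \<Rightarrow> bool" where
  "converges_in_prob M X Z \<longleftrightarrow>
     Z \<in> borel_measurable M \<and> (\<forall>n. X n \<in> borel_measurable M) \<and>
     (\<forall>\<epsilon>>0. (\<lambda>n. measure M {\<omega> \<in> space M. \<bar>X n \<omega> - Z \<omega>\<bar> > \<epsilon>}) \<longlonglongrightarrow> 0)"

end

theory Submission
  imports Defs
begin

text \<open>Integration by parts turns the pathwise integral into an average of increments,
  \<open>Y\<^sup>i\<^sub>t = \<nu>\<^sub>i \<integral> (B\<^sup>i\<^sub>t - B\<^sup>i\<^bsub>t-v\<^esub>) d\<mu>\<^sub>i(v)\<close> with \<open>\<mu>\<^sub>i\<close> the exponential law of rate \<open>\<alpha>\<^sub>i\<close>, so every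
  moment of \<open>Y\<close> is an average of moments of Gaussian increments. Covariances of increments are
  second differences of the kernel \<open>g x = (\<rho> - sign x \<eta>) \<bar>x\<bar>\<^sup>H / 2\<close>; they depend on the time
  difference only and tend to 0 at infinity because \<open>H < 2\<close>, and by dominated convergence so does
  the covariance of \<open>Y\<close>. The Wick formula for fourth moments survives averaging one argument at a
  time, so the products \<open>Y\<^sup>1 Y\<^sup>2\<close> have covariances tending to 0 and their empirical means converge
  in \<open>L\<^sup>2\<close>. The limits solve a linear system for \<open>\<rho>\<close> and \<open>\<eta>\<^sub>1\<^sub>2\<close>, since
  \<open>e\<^bsup>\<alpha>\<^sub>1s\<^esup> E(Y\<^sup>1\<^sub>s Y\<^sup>2\<^sub>0) - E(Y\<^sup>1\<^sub>0 Y\<^sup>2\<^sub>0) = \<nu>\<^sub>1 \<nu>\<^sub>2 H (H - 1) (\<rho> + \<eta>\<^sub>1\<^sub>2) / 2 I\<^sub>1\<^sub>2(s)\<close>, and symmetrically.\<close>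

section \<open>Fourth moments and the Wick formula\<close>

text \<open>The fractional processes are not stationary: their covariances contain powers of |t| and
  |s| separately. In a covariance of two increments these powers cancel, which is why everything is
  phrased with increments over exponentially distributed lags. The Gaussian law enters only through
  E f^4 = 3 (E f^2)^2 on linear combinations; the same fourth moments justify each exchange of
  integrals. No rate of decay is asked of the covariance of Y: Cesaro means of a null sequence are
  null, so all H < 2 are treated alike, although the cross-covariance may fail to be summable. The
  factor e^(\<alpha> s) in the estimators makes the contribution of the past before time 0 equal at
  times s and 0. It cancels in the difference and leaves an integral over [0, s], where the kernel
  has a single sign branch. For H < 1 the inner integral of I_ij blows up like u^(H-1) at u = 0, so
  the fundamental theorem is used on the open interval; dividing power increments by their exponent
  H - 1 makes them positive for H < 1 and H > 1 at once, and this positivity keeps the denominators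
  I_12 and I_21 away from 0.\<close>

lemma (in prob_space) centered_gaussian_fourth_moment:
  assumes "centered_gaussian M X"
  shows "integrable M (\<lambda>\<omega>. X \<omega> ^ 4)"
    and "expectation (\<lambda>\<omega>. X \<omega> ^ 4) = 3 * (expectation (\<lambda>\<omega>. (X \<omega>)\<^sup>2))\<^sup>2"
proof -
  have [measurable]: "X \<in> borel_measurable M"
    using assms by (simp add: centered_gaussian_def)
  consider (zero) "AE \<omega> in M. X \<omega> = 0"
    | (normal) \<sigma> where "\<sigma> > 0"
        "distributed M lborel X (\<lambda>x. ennreal (normal_density 0 \<sigma> x))"
    using assms by (auto simp: centered_gaussian_def)
  then have "integrable M (\<lambda>\<omega>. X \<omega> ^ 4) \<and>
      expectation (\<lambda>\<omega>. X \<omega> ^ 4) = 3 * (expectation (\<lambda>\<omega>. (X \<omega>)\<^sup>2))\<^sup>2"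
  proof cases
    case zero
    have "has_bochner_integral M (\<lambda>\<omega>. X \<omega> ^ 4) 0" "has_bochner_integral M (\<lambda>\<omega>. (X \<omega>)\<^sup>2) 0"
      using zero by (auto intro!: has_bochner_integralI_AE[OF has_bochner_integral_zero] elim: eventually_mono)
    then show ?thesis
      by (simp add: has_bochner_integral_iff)
  next
    case normal
    note d = normal(2)
    \<comment> \<open>The formula yields \<sigma>^2 for k = 1 and 3 \<sigma>^4 for k = 2.\<close>
    have m: "has_bochner_integral lborel (\<lambda>x. normal_density 0 \<sigma> x * x ^ (2 * k))
        (fact (2 * k) / ((2 / \<sigma>\<^sup>2) ^ k * fact k))" for k
      using normal_moment_even[OF normal(1), of 0 k] by simp
    have i: "integrable M (\<lambda>\<omega>. X \<omega> ^ (2 * k))" for k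
      by (subst distributed_integrable[OF d, symmetric])
        (use m[of k] in \<open>auto simp: has_bochner_integral_iff\<close>)
    have e: "expectation (\<lambda>\<omega>. X \<omega> ^ (2 * k)) = fact (2 * k) / ((2 / \<sigma>\<^sup>2) ^ k * fact k)" for k
      by (subst distributed_integral[OF d, symmetric])
        (use m[of k] in \<open>auto simp: has_bochner_integral_iff\<close>)
    show ?thesis
      using i[of 2] e[of 2] e[of 1] normal(1)
      by (simp add: field_simps fact_numeral power2_eq_square power4_eq_xxxx)
  qed
  then show "integrable M (\<lambda>\<omega>. X \<omega> ^ 4)"
    and "expectation (\<lambda>\<omega>. X \<omega> ^ 4) = 3 * (expectation (\<lambda>\<omega>. (X \<omega>)\<^sup>2))\<^sup>2"
    by auto
qed

text \<open>Fourth moments are the natural class: a covariance of two products Y^1 Y^2 is an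
  expectation of four factors. The class is stable under linear combinations and, later, under
  averaging.\<close>

definition L4 :: "'a measure \<Rightarrow> ('a \<Rightarrow> real) \<Rightarrow> bool" where
  "L4 M X \<longleftrightarrow> X \<in> borel_measurable M \<and> integrable M (\<lambda>\<omega>. X \<omega> ^ 4)"

lemma L4_measurable[measurable_dest]: "L4 M X \<Longrightarrow> X \<in> borel_measurable M"
  by (simp add: L4_def)

lemma abs_mult4_le: "\<bar>a * b * c * d\<bar> \<le> a ^ 4 + b ^ 4 + c ^ 4 + d ^ 4" for a b c d :: real
proof -
  have *: "\<bar>x * y\<bar> \<le> x\<^sup>2 + y\<^sup>2" for x y :: real
    using sum_squares_bound[of "\<bar>x\<bar>" "\<bar>y\<bar>"] abs_ge_zero[of "x * y"]
    unfolding abs_mult power2_abs by linarith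
  have **: "(x * y)\<^sup>2 \<le> (x ^ 4 + y ^ 4) / 2" for x y :: real
    using sum_squares_bound[of "x\<^sup>2" "y\<^sup>2"] by (simp add: power_mult_distrib)
  have "\<bar>(a * b) * (c * d)\<bar> \<le> (a * b)\<^sup>2 + (c * d)\<^sup>2" by (rule *)
  also have "\<dots> \<le> (a ^ 4 + b ^ 4) / 2 + (c ^ 4 + d ^ 4) / 2"
    by (intro add_mono **)
  also have "\<dots> \<le> a ^ 4 + b ^ 4 + c ^ 4 + d ^ 4"
  proof -
    have "(p + q) / 2 + (r + t) / 2 \<le> p + q + r + t"
      if "p \<ge> 0" "q \<ge> 0" "r \<ge> 0" "t \<ge> 0" for p q r t :: real
      using that by (simp add: field_simps)
    then show ?thesis by simp
  qed
  finally show ?thesis by (simp add: mult.assoc)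
qed

lemma L4_integrable_mult4:
  assumes "L4 M X1" "L4 M X2" "L4 M X3" "L4 M X4"
  shows "integrable M (\<lambda>\<omega>. X1 \<omega> * X2 \<omega> * X3 \<omega> * X4 \<omega>)"
proof -
  note [measurable] = assms[THEN L4_measurable]
  have "integrable M (\<lambda>\<omega>. X1 \<omega> ^ 4 + X2 \<omega> ^ 4 + X3 \<omega> ^ 4 + X4 \<omega> ^ 4)"
    using assms by (simp add: L4_def)
  then show ?thesis
    by (rule Bochner_Integration.integrable_bound)
      (auto intro!: AE_I2 order_trans[OF abs_mult4_le])
qed

lemma (in prob_space) L4_const: "L4 M (\<lambda>_. c)"
  by (simp add: L4_def)

lemma L4_add:
  assumes "L4 M X" "L4 M Y" shows "L4 M (\<lambda>\<omega>. X \<omega> + Y \<omega>)"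
proof -
  have "(x + y) ^ 4 = x * x * x * x + 4 * (x * x * x * y) + 6 * (x * x * y * y)
      + 4 * (x * y * y * y) + y * y * y * y" for x y :: real
    by (simp add: power4_eq_xxxx algebra_simps)
  moreover have "integrable M (\<lambda>\<omega>. X \<omega> * X \<omega> * X \<omega> * X \<omega> + 4 * (X \<omega> * X \<omega> * X \<omega> * Y \<omega>)
      + 6 * (X \<omega> * X \<omega> * Y \<omega> * Y \<omega>) + 4 * (X \<omega> * Y \<omega> * Y \<omega> * Y \<omega>) + Y \<omega> * Y \<omega> * Y \<omega> * Y \<omega>)"
    by (intro Bochner_Integration.integrable_add integrable_mult_right L4_integrable_mult4 assms)
  ultimately show ?thesis
    using assms by (auto simp: L4_def)
qed

lemma L4_cmult: "L4 M X \<Longrightarrow> L4 M (\<lambda>\<omega>. c * X \<omega>)"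
  by (auto simp: L4_def power_mult_distrib)

text \<open>A product of four factors, two of them the constant 1, which has a fourth moment because
  the total mass is finite.\<close>

lemma (in prob_space) L4_integrable_mult:
  assumes "L4 M X" "L4 M Y" shows "integrable M (\<lambda>\<omega>. X \<omega> * Y \<omega>)"
  using L4_integrable_mult4[OF assms L4_const[of 1] L4_const[of 1]] by simp

lemma (in prob_space) L4_integrable_power2:
  "L4 M X \<Longrightarrow> integrable M (\<lambda>\<omega>. (X \<omega>)\<^sup>2)"
  unfolding power2_eq_square by (rule L4_integrable_mult)

text \<open>Isserlis' identity as a property of four given variables rather than of a Gaussian
  vector, so that it can be carried from increments to their averages without showing that the
  averages are Gaussian.\<close>

definition wick :: "'a measure \<Rightarrow> ('a \<Rightarrow> real) \<Rightarrow> ('a \<Rightarrow> real) \<Rightarrow> ('a \<Rightarrow> real) \<Rightarrow> ('a \<Rightarrow> real) \<Rightarrow> bool"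
  where "wick M X1 X2 X3 X4 \<longleftrightarrow>
    (\<integral>\<omega>. X1 \<omega> * X2 \<omega> * X3 \<omega> * X4 \<omega> \<partial>M) =
      (\<integral>\<omega>. X1 \<omega> * X2 \<omega> \<partial>M) * (\<integral>\<omega>. X3 \<omega> * X4 \<omega> \<partial>M)
    + (\<integral>\<omega>. X1 \<omega> * X3 \<omega> \<partial>M) * (\<integral>\<omega>. X2 \<omega> * X4 \<omega> \<partial>M)
    + (\<integral>\<omega>. X1 \<omega> * X4 \<omega> \<partial>M) * (\<integral>\<omega>. X2 \<omega> * X3 \<omega> \<partial>M)"

text \<open>Averaging is available in the first argument only; a cyclic rotation brings each
  argument there in turn.\<close>

lemma wick_rotate: "wick M X1 X2 X3 X4 \<Longrightarrow> wick M X2 X3 X4 X1"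
  unfolding wick_def by (simp add: mult_ac add_ac)

text \<open>Polarization: summing \<open>\<epsilon>\<^sub>2 \<epsilon>\<^sub>3 \<epsilon>\<^sub>4 (X\<^sub>1 + \<epsilon>\<^sub>2 X\<^sub>2 + \<epsilon>\<^sub>3 X\<^sub>3 + \<epsilon>\<^sub>4 X\<^sub>4)^4\<close> over the eight choices of
  signs gives \<open>192 X\<^sub>1 X\<^sub>2 X\<^sub>3 X\<^sub>4\<close>.\<close>

lemma (in prob_space) wick_of_fourth_moments:
  assumes L: "L4 M X1" "L4 M X2" "L4 M X3" "L4 M X4"
    and fourth: "\<And>a b c. expectation (\<lambda>\<omega>. (X1 \<omega> + a * X2 \<omega> + b * X3 \<omega> + c * X4 \<omega>) ^ 4) =
      3 * (expectation (\<lambda>\<omega>. (X1 \<omega> + a * X2 \<omega> + b * X3 \<omega> + c * X4 \<omega>)\<^sup>2))\<^sup>2"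
  shows "wick M X1 X2 X3 X4"
proof -
  define P where "P a b c = expectation (\<lambda>\<omega>. (X1 \<omega> + a * X2 \<omega> + b * X3 \<omega> + c * X4 \<omega>) ^ 4)" for a b c
  have L': "L4 M (\<lambda>\<omega>. X1 \<omega> + a * X2 \<omega> + b * X3 \<omega> + c * X4 \<omega>)" for a b c
    by (intro L4_add L4_cmult L)
  have i4[simp]: "integrable M (\<lambda>\<omega>. (X1 \<omega> + a * X2 \<omega> + b * X3 \<omega> + c * X4 \<omega>) ^ 4)" for a b c
    using L' by (simp add: L4_def)
  have id: "192 * (x * y * z * w) =
      (x + 1 * y + 1 * z + 1 * w) ^ 4 - (x + 1 * y + 1 * z + (-1) * w) ^ 4
    - (x + 1 * y + (-1) * z + 1 * w) ^ 4 + (x + 1 * y + (-1) * z + (-1) * w) ^ 4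
    - (x + (-1) * y + 1 * z + 1 * w) ^ 4 + (x + (-1) * y + 1 * z + (-1) * w) ^ 4
    + (x + (-1) * y + (-1) * z + 1 * w) ^ 4 - (x + (-1) * y + (-1) * z + (-1) * w) ^ 4"
    for x y z w :: real
    by algebra
  have "192 * expectation (\<lambda>\<omega>. X1 \<omega> * X2 \<omega> * X3 \<omega> * X4 \<omega>)
      = expectation (\<lambda>\<omega>. 192 * (X1 \<omega> * X2 \<omega> * X3 \<omega> * X4 \<omega>))"
    by simp
  also have "\<dots> = P 1 1 1 - P 1 1 (-1) - P 1 (-1) 1 + P 1 (-1) (-1)
      - P (-1) 1 1 + P (-1) 1 (-1) + P (-1) (-1) 1 - P (-1) (-1) (-1)"
    unfolding id P_def
    by (simp only: i4 Bochner_Integration.integral_add Bochner_Integration.integral_diff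
        Bochner_Integration.integrable_add Bochner_Integration.integrable_diff)
  finally have 192: "192 * expectation (\<lambda>\<omega>. X1 \<omega> * X2 \<omega> * X3 \<omega> * X4 \<omega>) = \<dots>" .
  note i2[simp] = L[THEN L4_integrable_mult, OF L(1)] L[THEN L4_integrable_mult, OF L(2)]
    L[THEN L4_integrable_mult, OF L(3)] L[THEN L4_integrable_mult, OF L(4)]
  have sq: "expectation (\<lambda>\<omega>. (X1 \<omega> + a * X2 \<omega> + b * X3 \<omega> + c * X4 \<omega>)\<^sup>2) =
      expectation (\<lambda>\<omega>. X1 \<omega> * X1 \<omega>) + a\<^sup>2 * expectation (\<lambda>\<omega>. X2 \<omega> * X2 \<omega>)
      + b\<^sup>2 * expectation (\<lambda>\<omega>. X3 \<omega> * X3 \<omega>) + c\<^sup>2 * expectation (\<lambda>\<omega>. X4 \<omega> * X4 \<omega>)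
      + 2 * a * expectation (\<lambda>\<omega>. X1 \<omega> * X2 \<omega>) + 2 * b * expectation (\<lambda>\<omega>. X1 \<omega> * X3 \<omega>)
      + 2 * c * expectation (\<lambda>\<omega>. X1 \<omega> * X4 \<omega>) + 2 * a * b * expectation (\<lambda>\<omega>. X2 \<omega> * X3 \<omega>)
      + 2 * a * c * expectation (\<lambda>\<omega>. X2 \<omega> * X4 \<omega>) + 2 * b * c * expectation (\<lambda>\<omega>. X3 \<omega> * X4 \<omega>)"
    for a b c
  proof -
    have "(x + a * y + b * z + c * w)\<^sup>2 = x * x + a\<^sup>2 * (y * y) + b\<^sup>2 * (z * z) + c\<^sup>2 * (w * w)
      + (2 * a) * (x * y) + (2 * b) * (x * z) + (2 * c) * (x * w) + (2 * a * b) * (y * z)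
      + (2 * a * c) * (y * w) + (2 * b * c) * (z * w)" for x y z w :: real
      by algebra
    then show ?thesis by simp
  qed
  \<comment> \<open>Only terms odd in each of a, b, c survive the signed sum. In 3 q^2 they are 24 a
    b c times the sum over the three pairings, and the eight sign choices turn 24 into the same
    192.\<close>
  have alg: "e = m12 * m34 + m13 * m24 + m14 * m23"
    if "192 * e = Q 1 1 1 - Q 1 1 (-1) - Q 1 (-1) 1 + Q 1 (-1) (-1)
        - Q (-1) 1 1 + Q (-1) 1 (-1) + Q (-1) (-1) 1 - Q (-1) (-1) (-1)"
      and "\<And>a b c. Q a b c = 3 * (m11 + a\<^sup>2 * m22 + b\<^sup>2 * m33 + c\<^sup>2 * m44 + 2 * a * m12 + 2 * b * m13
        + 2 * c * m14 + 2 * a * b * m23 + 2 * a * c * m24 + 2 * b * c * m34)\<^sup>2"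
    for e m11 m22 m33 m44 m12 m13 m14 m23 m24 m34 :: real and Q
    using that(1) unfolding that(2) by (simp add: power2_eq_square algebra_simps)
  show ?thesis
    unfolding wick_def by (rule alg[OF 192]) (simp add: P_def fourth sq)
qed

section \<open>Averaging a family of random variables\<close>

text \<open>The parameter v of a family \<open>U v\<close> is integrated out under a law \<mu>.
  Joint integrability of the fourth power is the one assumption from which every use of Fubini
  follows, for products with up to three further \<open>L4\<close> factors.\<close>

locale averaging = P: prob_space M + Q: prob_space \<mu> for M :: "'a measure" and \<mu> :: "real measure" +
  fixes U :: "real \<Rightarrow> 'a \<Rightarrow> real"
  assumes U_measurable[measurable]: "case_prod U \<in> borel_measurable (\<mu> \<Otimes>\<^sub>M M)"
    and U4: "integrable (\<mu> \<Otimes>\<^sub>M M) (\<lambda>(v, \<omega>). U v \<omega> ^ 4)"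
begin

sublocale PQ: pair_prob_space \<mu> M ..

definition avg :: "'a \<Rightarrow> real" where "avg \<omega> = (\<integral>v. U v \<omega> \<partial>\<mu>)"

lemma avg_measurable[measurable]: "avg \<in> borel_measurable M"
  unfolding avg_def by measurable

lemma integrable_mult3:
  assumes "L4 M X2" "L4 M X3" "L4 M X4"
  shows "integrable (\<mu> \<Otimes>\<^sub>M M) (\<lambda>(v, \<omega>). U v \<omega> * X2 \<omega> * X3 \<omega> * X4 \<omega>)"
proof -
  note [measurable] = assms[THEN L4_measurable]
  have X: "integrable (\<mu> \<Otimes>\<^sub>M M) (\<lambda>(v, \<omega>). X \<omega> ^ 4)" if "L4 M X" for X
  proof -
    note [measurable] = L4_measurable[OF that]
    show ?thesis
      using that by (intro PQ.Fubini_integrable) (auto simp: L4_def)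
  qed
  have "integrable (\<mu> \<Otimes>\<^sub>M M) (\<lambda>(v, \<omega>). U v \<omega> ^ 4 + X2 \<omega> ^ 4 + X3 \<omega> ^ 4 + X4 \<omega> ^ 4)"
    using assms[THEN X] U4 by (simp add: case_prod_unfold)
  then show ?thesis
    by (rule Bochner_Integration.integrable_bound)
      (auto intro!: AE_I2 order_trans[OF abs_mult4_le])
qed

lemma integrable_mult1:
  assumes "L4 M X" shows "integrable (\<mu> \<Otimes>\<^sub>M M) (\<lambda>(v, \<omega>). U v \<omega> * X \<omega>)"
  using integrable_mult3[OF assms P.L4_const[of 1] P.L4_const[of 1]] by simp

lemma AE_integrable_U: "AE \<omega> in M. integrable \<mu> (\<lambda>v. U v \<omega>)"
  using PQ.AE_integrable_snd[of U] integrable_mult1[OF P.L4_const[of 1]] by simp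

text \<open>Jensen's inequality for x^4 on almost every path bounds \<open>avg \<omega> ^ 4\<close>
  by the average of the fourth powers, which is integrable by Fubini. Hence an average may itself
  serve as a fixed factor when the next argument is averaged.\<close>

lemma L4_avg: "L4 M avg"
proof -
  have 1: "integrable M (\<lambda>\<omega>. \<integral>v. U v \<omega> ^ 4 \<partial>\<mu>)"
    using PQ.integrable_snd[of "\<lambda>v \<omega>. U v \<omega> ^ 4"] U4 by simp
  have "AE \<omega> in M. integrable \<mu> (\<lambda>v. U v \<omega> ^ 4)"
    using PQ.AE_integrable_snd[of "\<lambda>v \<omega>. U v \<omega> ^ 4"] U4 by simp
  with AE_integrable_U have "AE \<omega> in M. avg \<omega> ^ 4 \<le> (\<integral>v. U v \<omega> ^ 4 \<partial>\<mu>)"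
  proof eventually_elim
    case (elim \<omega>)
    then show ?case
      unfolding avg_def
      by (intro Q.jensens_inequality[where q = "\<lambda>x. x ^ 4" and I = UNIV])
        (auto intro!: convex_power_even)
  qed
  then have "AE \<omega> in M. norm (avg \<omega> ^ 4) \<le> norm (\<integral>v. U v \<omega> ^ 4 \<partial>\<mu>)"
    by eventually_elim auto
  then have "integrable M (\<lambda>\<omega>. avg \<omega> ^ 4)"
    by (intro Bochner_Integration.integrable_bound[OF 1]) auto
  then show ?thesis by (simp add: L4_def)
qed

lemma integral_avg_mult3:
  assumes "L4 M X2" "L4 M X3" "L4 M X4"
  shows "(\<integral>\<omega>. avg \<omega> * X2 \<omega> * X3 \<omega> * X4 \<omega> \<partial>M) = (\<integral>v. (\<integral>\<omega>. U v \<omega> * X2 \<omega> * X3 \<omega> * X4 \<omega> \<partial>M) \<partial>\<mu>)"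
    and "integrable \<mu> (\<lambda>v. \<integral>\<omega>. U v \<omega> * X2 \<omega> * X3 \<omega> * X4 \<omega> \<partial>M)"
proof -
  note i = integrable_mult3[OF assms]
  show "integrable \<mu> (\<lambda>v. \<integral>\<omega>. U v \<omega> * X2 \<omega> * X3 \<omega> * X4 \<omega> \<partial>M)"
    using PQ.integrable_fst[OF i] by simp
  show "(\<integral>\<omega>. avg \<omega> * X2 \<omega> * X3 \<omega> * X4 \<omega> \<partial>M) = (\<integral>v. (\<integral>\<omega>. U v \<omega> * X2 \<omega> * X3 \<omega> * X4 \<omega> \<partial>M) \<partial>\<mu>)"
    unfolding PQ.Fubini_integral[OF i, symmetric]
    by (simp add: avg_def mult.assoc)
qed

lemma integral_avg_mult:
  assumes "L4 M X"
  shows "(\<integral>\<omega>. avg \<omega> * X \<omega> \<partial>M) = (\<integral>v. (\<integral>\<omega>. U v \<omega> * X \<omega> \<partial>M) \<partial>\<mu>)"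
    and "integrable \<mu> (\<lambda>v. \<integral>\<omega>. U v \<omega> * X \<omega> \<partial>M)"
  using integral_avg_mult3[OF assms P.L4_const[of 1] P.L4_const[of 1]] by simp_all

text \<open>Both sides of the identity are linear in the first argument, and Fubini moves the
  average over v outside each expectation.\<close>

lemma wick_avg:
  assumes L: "L4 M X2" "L4 M X3" "L4 M X4"
    and w: "\<And>v. wick M (U v) X2 X3 X4"
  shows "wick M avg X2 X3 X4"
  using w unfolding wick_def
  by (simp add: integral_avg_mult3[OF L] integral_avg_mult[OF L(1)] integral_avg_mult[OF L(2)]
      integral_avg_mult[OF L(3)])

end

section \<open>Mean convergence of averages\<close>

lemma Cesaro_tendsto_zero:
  fixes r :: "nat \<Rightarrow> real"
  assumes "r \<longlonglongrightarrow> 0"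
  shows "(\<lambda>n. (\<Sum>k<n. r k) / real n) \<longlonglongrightarrow> 0"
proof (rule LIMSEQ_I)
  fix \<epsilon> :: real assume \<epsilon>: "\<epsilon> > 0"
  obtain N where N: "\<And>k. k \<ge> N \<Longrightarrow> \<bar>r k\<bar> < \<epsilon> / 2"
    using LIMSEQ_D[OF assms, of "\<epsilon> / 2"] \<epsilon> by auto
  define S where "S = (\<Sum>k<N. \<bar>r k\<bar>)"
  have S: "S \<ge> 0" by (simp add: S_def sum_nonneg)
  obtain N' :: nat where N': "real N' > 2 * S / \<epsilon>"
    using reals_Archimedean2 by blast
  show "\<exists>n0. \<forall>n\<ge>n0. norm ((\<Sum>k<n. r k) / real n - 0) < \<epsilon>"
  proof (intro exI allI impI)
    fix n assume n: "n \<ge> max N (Suc N')"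
    have "\<bar>\<Sum>k<n. r k\<bar> \<le> (\<Sum>k<n. \<bar>r k\<bar>)" by (rule sum_abs)
    also have "\<dots> = S + (\<Sum>k\<in>{N..<n}. \<bar>r k\<bar>)"
      using n unfolding S_def lessThan_atLeast0 by (intro sum.atLeastLessThan_concat[symmetric]) auto
    also have "(\<Sum>k\<in>{N..<n}. \<bar>r k\<bar>) \<le> (\<Sum>k\<in>{N..<n}. \<epsilon> / 2)"
      by (intro sum_mono less_imp_le[OF N]) auto
    also have "\<dots> = real (n - N) * (\<epsilon> / 2)" by simp
    also have "\<dots> \<le> real n * (\<epsilon> / 2)"
      using \<epsilon> by (intro mult_right_mono) auto
    also have "S < real n * (\<epsilon> / 2)"
    proof -
      have "2 * S / \<epsilon> < real n" using N' n by linarith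
      then show ?thesis using \<epsilon> by (simp add: field_simps)
    qed
    finally have "\<bar>\<Sum>k<n. r k\<bar> < real n * \<epsilon>" by (simp add: field_simps)
    then show "norm ((\<Sum>k<n. r k) / real n - 0) < \<epsilon>"
      using n by (simp add: abs_divide field_simps)
  qed
qed

lemma converges_L2_add:
  assumes "prob_space M" "converges_L2 M X (\<lambda>_. a)" "converges_L2 M Y (\<lambda>_. b)"
  shows "converges_L2 M (\<lambda>n \<omega>. X n \<omega> + Y n \<omega>) (\<lambda>_. a + b)"
proof -
  interpret prob_space M by fact
  have [measurable]: "X n \<in> borel_measurable M" "Y n \<in> borel_measurable M" for n
    using assms by (auto simp: converges_L2_def)
  have ineq: "(x + y)\<^sup>2 \<le> 2 * x\<^sup>2 + 2 * y\<^sup>2" for x y :: real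
    using sum_squares_bound[of x y] by (simp add: power2_sum)
  have dom: "integrable M (\<lambda>\<omega>. (f \<omega> + g \<omega>)\<^sup>2)"
    if "integrable M (\<lambda>\<omega>. (f \<omega>)\<^sup>2)" "integrable M (\<lambda>\<omega>. (g \<omega>)\<^sup>2)"
      "f \<in> borel_measurable M" "g \<in> borel_measurable M" for f g :: "'a \<Rightarrow> real"
  proof (rule Bochner_Integration.integrable_bound)
    show "integrable M (\<lambda>\<omega>. 2 * (f \<omega>)\<^sup>2 + 2 * (g \<omega>)\<^sup>2)" using that by simp
  qed (use that in \<open>auto intro!: AE_I2 order_trans[OF ineq]\<close>)
  have X2: "integrable M (\<lambda>\<omega>. (X n \<omega>)\<^sup>2)" and Y2: "integrable M (\<lambda>\<omega>. (Y n \<omega>)\<^sup>2)" for n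
    using assms by (auto simp: converges_L2_def)
  have X': "integrable M (\<lambda>\<omega>. (X n \<omega> - a)\<^sup>2)" and Y': "integrable M (\<lambda>\<omega>. (Y n \<omega> - b)\<^sup>2)" for n
    using dom[OF X2[of n], of "\<lambda>_. - a"] dom[OF Y2[of n], of "\<lambda>_. - b"] by auto
  have "(\<lambda>n. expectation (\<lambda>\<omega>. (X n \<omega> + Y n \<omega> - (a + b))\<^sup>2)) \<longlonglongrightarrow> 0"
  proof (rule tendsto_sandwich[OF _ _ tendsto_const])
    show "(\<lambda>n. 2 * expectation (\<lambda>\<omega>. (X n \<omega> - a)\<^sup>2) + 2 * expectation (\<lambda>\<omega>. (Y n \<omega> - b)\<^sup>2)) \<longlonglongrightarrow> 0"
      using assms by (auto simp: converges_L2_def intro!: tendsto_eq_intros)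
    show "\<forall>\<^sub>F n in sequentially. expectation (\<lambda>\<omega>. (X n \<omega> + Y n \<omega> - (a + b))\<^sup>2)
        \<le> 2 * expectation (\<lambda>\<omega>. (X n \<omega> - a)\<^sup>2) + 2 * expectation (\<lambda>\<omega>. (Y n \<omega> - b)\<^sup>2)"
    proof (intro always_eventually allI)
      fix n
      have "expectation (\<lambda>\<omega>. (X n \<omega> + Y n \<omega> - (a + b))\<^sup>2)
          \<le> expectation (\<lambda>\<omega>. 2 * (X n \<omega> - a)\<^sup>2 + 2 * (Y n \<omega> - b)\<^sup>2)"
      proof (rule integral_mono_AE')
        show "integrable M (\<lambda>\<omega>. 2 * (X n \<omega> - a)\<^sup>2 + 2 * (Y n \<omega> - b)\<^sup>2)"
          using X' Y' by simp
        show "AE \<omega> in M. (X n \<omega> + Y n \<omega> - (a + b))\<^sup>2 \<le> 2 * (X n \<omega> - a)\<^sup>2 + 2 * (Y n \<omega> - b)\<^sup>2"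
          using ineq[of "X n _ - a" "Y n _ - b"] by (intro AE_I2) (simp add: algebra_simps)
      qed auto
      then show "expectation (\<lambda>\<omega>. (X n \<omega> + Y n \<omega> - (a + b))\<^sup>2)
        \<le> 2 * expectation (\<lambda>\<omega>. (X n \<omega> - a)\<^sup>2) + 2 * expectation (\<lambda>\<omega>. (Y n \<omega> - b)\<^sup>2)"
        using X' Y' by simp
    qed
  qed simp
  then show ?thesis
    using dom[OF X2 Y2] by (auto simp: converges_L2_def)
qed

lemma converges_L2_cmult:
  assumes "prob_space M" "converges_L2 M X (\<lambda>_. a)"
  shows "converges_L2 M (\<lambda>n \<omega>. c * X n \<omega>) (\<lambda>_. c * a)"
proof -
  interpret prob_space M by fact
  have [measurable]: "X n \<in> borel_measurable M" for n
    using assms by (auto simp: converges_L2_def)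
  have "(c * x - c * a)\<^sup>2 = c\<^sup>2 * (x - a)\<^sup>2" for x
    by (simp add: power2_eq_square algebra_simps)
  then show ?thesis
    using assms by (auto simp: converges_L2_def power_mult_distrib intro!: tendsto_eq_intros)
qed

lemma converges_L2_imp_in_prob:
  assumes "prob_space M" "converges_L2 M X (\<lambda>_. a)"
  shows "converges_in_prob M X (\<lambda>_. a)"
proof -
  interpret prob_space M by fact
  have [measurable]: "X n \<in> borel_measurable M" for n
    using assms by (auto simp: converges_L2_def)
  have i: "integrable M (\<lambda>\<omega>. (X n \<omega> - a)\<^sup>2)" for n
  proof (rule Bochner_Integration.integrable_bound)
    show "integrable M (\<lambda>\<omega>. 2 * (X n \<omega>)\<^sup>2 + 2 * a\<^sup>2)"
      using assms by (auto simp: converges_L2_def)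
    have "(x - a)\<^sup>2 \<le> 2 * x\<^sup>2 + 2 * a\<^sup>2" for x :: real
      using sum_squares_bound[of x "- a"] by (simp add: power2_diff)
    then show "AE \<omega> in M. norm ((X n \<omega> - a)\<^sup>2) \<le> norm (2 * (X n \<omega>)\<^sup>2 + 2 * a\<^sup>2)"
      by (intro AE_I2) simp
  qed simp
  have "(\<lambda>n. measure M {\<omega> \<in> space M. \<bar>X n \<omega> - a\<bar> > \<epsilon>}) \<longlonglongrightarrow> 0" if \<epsilon>: "\<epsilon> > 0" for \<epsilon>
  proof (rule tendsto_sandwich[OF _ _ tendsto_const])
    show "(\<lambda>n. expectation (\<lambda>\<omega>. (X n \<omega> - a)\<^sup>2) / \<epsilon>\<^sup>2) \<longlonglongrightarrow> 0"
      using assms \<epsilon> by (auto simp: converges_L2_def intro!: tendsto_eq_intros)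
    show "\<forall>\<^sub>F n in sequentially. measure M {\<omega> \<in> space M. \<bar>X n \<omega> - a\<bar> > \<epsilon>}
        \<le> expectation (\<lambda>\<omega>. (X n \<omega> - a)\<^sup>2) / \<epsilon>\<^sup>2"
    proof (intro always_eventually allI)
      fix n
      have "measure M {\<omega> \<in> space M. \<bar>X n \<omega> - a\<bar> > \<epsilon>}
          \<le> measure M {\<omega> \<in> space M. (X n \<omega> - a)\<^sup>2 \<ge> \<epsilon>\<^sup>2}"
        using \<epsilon> by (intro finite_measure_mono) (auto simp flip: abs_le_square_iff)
      also have "\<dots> \<le> expectation (\<lambda>\<omega>. (X n \<omega> - a)\<^sup>2) / \<epsilon>\<^sup>2"
        using \<epsilon> i by (intro integral_Markov_inequality_measure[where A = "space M"]) auto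
      finally show "measure M {\<omega> \<in> space M. \<bar>X n \<omega> - a\<bar> > \<epsilon>} \<le> \<dots>" .
    qed
  qed simp
  then show ?thesis by (auto simp: converges_in_prob_def)
qed

text \<open>Measurability of \<open>X n\<close> is assumed separately because M need not be
  complete: almost sure equality with a measurable function does not provide it.\<close>

lemma converges_L2_cong:
  assumes "\<And>n. X n \<in> borel_measurable M" "\<And>n. AE \<omega> in M. X n \<omega> = X' n \<omega>"
    and "converges_L2 M X' (\<lambda>_. a)"
  shows "converges_L2 M X (\<lambda>_. a)"
proof -
  have [measurable]: "X n \<in> borel_measurable M" "X' n \<in> borel_measurable M" for n
    using assms by (auto simp: converges_L2_def)
  have "integrable M (\<lambda>\<omega>. (X n \<omega>)\<^sup>2) \<longleftrightarrow> integrable M (\<lambda>\<omega>. (X' n \<omega>)\<^sup>2)" for n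
    using assms(2)[of n] by (intro integrable_cong_AE) (auto elim: eventually_mono)
  moreover have "(\<integral>\<omega>. (X n \<omega> - a)\<^sup>2 \<partial>M) = (\<integral>\<omega>. (X' n \<omega> - a)\<^sup>2 \<partial>M)" for n
    using assms(2)[of n] by (intro integral_cong_AE) (auto elim: eventually_mono)
  ultimately show ?thesis
    using assms(3) by (simp add: converges_L2_def)
qed

text \<open>The second moment of the centered mean is a double sum of r(|j - k|) over n^2. Each row
  meets every lag at most twice, so the sum is at most 2 n times the sum of |r k| for k < n, and
  Cesaro's theorem concludes. There are n - s summands but the normalization is n, as in the
  estimators.\<close>

lemma converges_L2_mean:
  fixes X :: "nat \<Rightarrow> 'a \<Rightarrow> real" and r :: "nat \<Rightarrow> real"
  assumes "prob_space M"
    and [measurable]: "\<And>j. X j \<in> borel_measurable M"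
    and X2: "\<And>j. integrable M (\<lambda>\<omega>. (X j \<omega>)\<^sup>2)"
    and mean: "\<And>j. (\<integral>\<omega>. X j \<omega> \<partial>M) = c"
    and cov: "\<And>j k. j \<le> k \<Longrightarrow> (\<integral>\<omega>. X j \<omega> * X k \<omega> \<partial>M) - c\<^sup>2 = r (k - j)"
    and r: "r \<longlonglongrightarrow> 0"
  shows "converges_L2 M (\<lambda>n \<omega>. 1 / real n * (\<Sum>j=1..n - s. X j \<omega>)) (\<lambda>_. c)"
proof -
  interpret prob_space M by fact
  have X1[simp]: "integrable M (X j)" for j
    using square_integrable_imp_integrable[OF _ X2] by simp
  have XX[simp]: "integrable M (\<lambda>\<omega>. X j \<omega> * X k \<omega>)" for j k
  proof (rule Bochner_Integration.integrable_bound)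
    show "integrable M (\<lambda>\<omega>. (X j \<omega>)\<^sup>2 + (X k \<omega>)\<^sup>2)" using X2 by simp
    have "\<bar>x * y\<bar> \<le> x\<^sup>2 + y\<^sup>2" for x y :: real
      using sum_squares_bound[of "\<bar>x\<bar>" "\<bar>y\<bar>"] abs_ge_zero[of "x * y"]
      unfolding abs_mult power2_abs by linarith
    then show "AE \<omega> in M. norm (X j \<omega> * X k \<omega>) \<le> norm ((X j \<omega>)\<^sup>2 + (X k \<omega>)\<^sup>2)"
      by (intro AE_I2) simp
  qed simp
  have cov': "(\<integral>\<omega>. (X j \<omega> - c) * (X k \<omega> - c) \<partial>M) = r (max j k - min j k)" for j k
  proof -
    have "(\<integral>\<omega>. (X j \<omega> - c) * (X k \<omega> - c) \<partial>M)
        = (\<integral>\<omega>. X j \<omega> * X k \<omega> - c * X j \<omega> - c * X k \<omega> + c * c \<partial>M)"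
      by (simp add: algebra_simps)
    also have "\<dots> = (\<integral>\<omega>. X j \<omega> * X k \<omega> \<partial>M) - c\<^sup>2"
      by (simp add: mean prob_space power2_eq_square)
    also have "\<dots> = r (max j k - min j k)"
      using cov[of j k] cov[of k j] by (cases "j \<le> k") (auto simp: mult.commute max_def min_def)
    finally show ?thesis .
  qed
  have i[simp]: "integrable M (\<lambda>\<omega>. (X j \<omega> - c) * (X k \<omega> - c))" for j k
    by (simp add: algebra_simps)
  \<comment> \<open>\<open>max j k - min j k\<close> is |j - k| without truncated
    subtraction.\<close>
  define V where "V n = (\<Sum>j=1..n. \<Sum>k=1..n. r (max j k - min j k))" for n :: nat
  have V_le: "V n \<le> 2 * real n * (\<Sum>k<n. \<bar>r k\<bar>)" for n
  proof -
    have "(\<Sum>k=1..n. \<bar>r (max j k - min j k)\<bar>) \<le> 2 * (\<Sum>k<n. \<bar>r k\<bar>)" if "j \<in> {1..n}" for j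
    proof -
      have "(\<Sum>k=1..n. \<bar>r (max j k - min j k)\<bar>)
          = (\<Sum>k\<in>{1..j}. \<bar>r (j - k)\<bar>) + (\<Sum>k\<in>{j<..n}. \<bar>r (k - j)\<bar>)"
      proof -
        have "{1..n} = {1..j} \<union> {j<..n}" using that by auto
        then have "(\<Sum>k=1..n. \<bar>r (max j k - min j k)\<bar>)
          = (\<Sum>k\<in>{1..j}. \<bar>r (max j k - min j k)\<bar>) + (\<Sum>k\<in>{j<..n}. \<bar>r (max j k - min j k)\<bar>)"
          by (simp add: sum.union_disjoint disjoint_iff)
        also have "\<dots> = (\<Sum>k\<in>{1..j}. \<bar>r (j - k)\<bar>) + (\<Sum>k\<in>{j<..n}. \<bar>r (k - j)\<bar>)"
          by (intro arg_cong2[where f = "(+)"] sum.cong) (auto simp: max_def min_def)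
        finally show ?thesis .
      qed
      also have "(\<Sum>k\<in>{1..j}. \<bar>r (j - k)\<bar>) = (\<Sum>i\<in>(\<lambda>k. j - k) ` {1..j}. \<bar>r i\<bar>)"
        by (subst sum.reindex) (auto simp: inj_on_def)
      also have "\<dots> \<le> (\<Sum>k<n. \<bar>r k\<bar>)"
        using that by (intro sum_mono2) auto
      also have "(\<Sum>k\<in>{j<..n}. \<bar>r (k - j)\<bar>) = (\<Sum>i\<in>(\<lambda>k. k - j) ` {j<..n}. \<bar>r i\<bar>)"
        by (subst sum.reindex) (auto simp: inj_on_def)
      also have "\<dots> \<le> (\<Sum>k<n. \<bar>r k\<bar>)"
        using that by (intro sum_mono2) auto
      finally show ?thesis by simp
    qed
    then have "(\<Sum>j=1..n. \<Sum>k=1..n. \<bar>r (max j k - min j k)\<bar>) \<le> (\<Sum>j=1..n. 2 * (\<Sum>k<n. \<bar>r k\<bar>))"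
      by (rule sum_mono)
    moreover have "V n \<le> (\<Sum>j=1..n. \<Sum>k=1..n. \<bar>r (max j k - min j k)\<bar>)"
      unfolding V_def by (intro sum_mono abs_ge_self)
    ultimately show ?thesis by simp
  qed
  define S where "S n \<omega> = 1 / real n * (\<Sum>j=1..n - s. X j \<omega>)" for n \<omega>
  have S[measurable]: "S n \<in> borel_measurable M" for n
    unfolding S_def by measurable
  have S2: "integrable M (\<lambda>\<omega>. (S n \<omega>)\<^sup>2)" for n
    unfolding S_def power_mult_distrib power2_eq_square[of "\<Sum>j=1..n - s. X j _"] sum_product
    by (intro integrable_mult_right Bochner_Integration.integrable_sum XX)
  define D where "D n \<omega> = 1 / real n * (\<Sum>j=1..n - s. X j \<omega> - c)" for n \<omega>
  have [measurable]: "D n \<in> borel_measurable M" for n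
    unfolding D_def by measurable
  have D2: "expectation (\<lambda>\<omega>. (D n \<omega>)\<^sup>2) = V (n - s) / (real n)\<^sup>2" for n
    unfolding D_def power_mult_distrib power2_eq_square[of "\<Sum>j=1..n - s. X j _ - c"] sum_product V_def
    by (simp add: cov' power_divide)
  have D2i: "integrable M (\<lambda>\<omega>. (D n \<omega>)\<^sup>2)" for n
    unfolding D_def power_mult_distrib power2_eq_square[of "\<Sum>j=1..n - s. X j _ - c"] sum_product
    by (intro integrable_mult_right Bochner_Integration.integrable_sum i)
  have "converges_L2 M D (\<lambda>_. 0)"
  proof -
    have "(\<lambda>n. V (n - s) / (real n)\<^sup>2) \<longlonglongrightarrow> 0"
    proof (rule tendsto_sandwich[OF _ _ tendsto_const])
      \<comment> \<open>The lower bound 0 is not visible from the double sum, as r may change sign;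
        it comes from V being a second moment up to the factor n^2.\<close>
      have "V (n - s) / (real n)\<^sup>2 = expectation (\<lambda>\<omega>. (D n \<omega>)\<^sup>2)" for n by (simp add: D2)
      then show "\<forall>\<^sub>F n in sequentially. 0 \<le> V (n - s) / (real n)\<^sup>2" by simp
      show "(\<lambda>n. 2 * ((\<Sum>k<n. \<bar>r k\<bar>) / real n)) \<longlonglongrightarrow> 0"
        using tendsto_mult_left[OF Cesaro_tendsto_zero, of "\<lambda>k. \<bar>r k\<bar>" 2] r
        by (simp add: tendsto_rabs_zero_iff)
      show "\<forall>\<^sub>F n in sequentially. V (n - s) / (real n)\<^sup>2 \<le> 2 * ((\<Sum>k<n. \<bar>r k\<bar>) / real n)"
        using eventually_gt_at_top[of 0]
      proof eventually_elim
        case (elim n)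
        have "V (n - s) \<le> 2 * real (n - s) * (\<Sum>k<n - s. \<bar>r k\<bar>)" by (rule V_le)
        also have "\<dots> \<le> 2 * real n * (\<Sum>k<n. \<bar>r k\<bar>)"
          by (intro mult_mono sum_mono2) (auto intro: sum_nonneg)
        finally show ?case using elim by (simp add: field_simps power2_eq_square)
      qed
    qed
    then show ?thesis using D2i by (simp add: converges_L2_def D2)
  qed
  \<comment> \<open>The deterministic remainder: the mean of n - s summands divided by n is c (n -
    s) / n, whose limit is c.\<close>
  moreover have "converges_L2 M (\<lambda>n _. c * (real (n - s) / real n)) (\<lambda>_. c)"
  proof -
    have "(\<lambda>n. real s / real n) \<longlonglongrightarrow> 0" by (rule lim_const_over_n)
    then have "(\<lambda>n. 1 - real s / real n) \<longlonglongrightarrow> 1 - 0" by (intro tendsto_intros)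
    moreover have "\<forall>\<^sub>F n in sequentially. 1 - real s / real n = real (n - s) / real n"
      using eventually_gt_at_top[of s]
      by eventually_elim (simp add: field_simps of_nat_diff)
    ultimately have "(\<lambda>n. real (n - s) / real n) \<longlonglongrightarrow> 1"
      by (simp add: tendsto_cong)
    then have "(\<lambda>n. (c * (real (n - s) / real n) - c)\<^sup>2) \<longlonglongrightarrow> (c * 1 - c)\<^sup>2"
      by (intro tendsto_intros)
    then show ?thesis by (simp add: converges_L2_def prob_space)
  qed
  ultimately have "converges_L2 M (\<lambda>n \<omega>. D n \<omega> + c * (real (n - s) / real n)) (\<lambda>_. 0 + c)"
    by (intro converges_L2_add) (rule assms)
  moreover have "D n \<omega> + c * (real (n - s) / real n) = S n \<omega>" for n \<omega>
    by (simp add: D_def S_def sum_subtractf right_diff_distrib)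
  ultimately show ?thesis by (simp add: S_def)
qed

section \<open>Riemann--Stieltjes integrals along a continuous path\<close>

text \<open>Existence of the integral is given; only its value has to be found. On each cell of a
  fine division the summand differs from the increment of a candidate primitive by at most 2e times
  the increment of f, and since f is nondecreasing these errors telescope to 2e (f b - f a).\<close>

lemma rs_integral_by_parts:
  fixes f f' g :: "real \<Rightarrow> real"
  assumes ab: "a < b"
    and f': "\<And>x. (f has_real_derivative f' x) (at x)" and f'_pos: "\<And>x. f' x \<ge> 0"
    and f'_cont: "continuous_on UNIV f'" and g: "continuous_on UNIV g"
    and J: "has_rs_integral f g a b J"
  shows "J = f b * g b - f a * g a - integral {a..b} (\<lambda>u. f' u * g u)"
proof -
  have f_mono: "f x \<le> f y" if "x \<le> y" for x y
    using that f' f'_pos by (intro DERIV_nonneg_imp_nondecreasing[OF that]) blast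
  have int: "(\<lambda>u. f' u * g u) integrable_on {x..y}" "f' integrable_on {x..y}" for x y
    by (intro integrable_continuous_real continuous_on_mult continuous_on_subset[OF f'_cont]
        continuous_on_subset[OF g]; simp)+
  have FTC: "integral {x..y} f' = f y - f x" if "x \<le> y" for x y
    by (intro integral_unique fundamental_theorem_of_calculus that)
      (metis f' has_real_derivative_iff_has_vector_derivative has_vector_derivative_at_within)
  \<comment> \<open>The candidate primitive of f dg: formally d(f g) - g df, with df = f'
    du.\<close>
  define \<Phi> where "\<Phi> x = f x * g x - integral {a..x} (\<lambda>u. f' u * g u)" for x
  have "\<bar>J - (\<Phi> b - \<Phi> a)\<bar> \<le> 2 * e * (f b - f a) + e" if e: "e > 0" for e
  proof -
    have "uniformly_continuous_on {a..b} g"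
      by (intro compact_uniformly_continuous continuous_on_subset[OF g]) auto
    then obtain d where d: "d > 0" and
      gd: "\<And>x y. x \<in> {a..b} \<Longrightarrow> y \<in> {a..b} \<Longrightarrow> dist y x < d \<Longrightarrow> dist (g y) (g x) < e"
      using e unfolding uniformly_continuous_on_def by metis
    obtain d' where d': "d' > 0" and
      Jd: "\<And>p. p tagged_division_of {a..b} \<Longrightarrow> (\<lambda>x. ball x d') fine p \<Longrightarrow>
        \<bar>(\<Sum>(x, k)\<in>p. f x * (g (Sup k) - g (Inf k))) - J\<bar> < e"
      using J e unfolding has_rs_integral_def by meson
    have "gauge (\<lambda>x. ball x (min d d'))"
      using d d' by (intro gauge_ball_dependent) auto
    then obtain p where p: "p tagged_division_of {a..b}" and fine: "(\<lambda>x. ball x (min d d')) fine p"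
      using fine_division_exists_real by blast
    have "(\<lambda>x. ball x d') fine p"
      using fine by (force simp: fine_def)
    from Jd[OF p this] have 1: "\<bar>(\<Sum>(x, k)\<in>p. f x * (g (Sup k) - g (Inf k))) - J\<bar> < e" .
    have bound: "\<bar>f x * (g (Sup k) - g (Inf k)) - (\<Phi> (Sup k) - \<Phi> (Inf k))\<bar>
        \<le> 2 * e * (f (Sup k) - f (Inf k))" if xk: "(x, k) \<in> p" for x k
    proof -
      obtain l r where k: "k = {l..r}"
        using tagged_division_ofD(4)[OF p xk] by auto
      have xk': "x \<in> k" "k \<subseteq> {a..b}" using tagged_division_ofD(2,3)[OF p xk] by auto
      then have lr: "l \<le> r" "l \<le> x" "x \<le> r" "a \<le> l" "r \<le> b" using k by auto
      have gx: "\<bar>g y - g x\<bar> \<le> e" if "y \<in> {l..r}" for y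
      proof -
        have "y \<in> ball x (min d d')" using fine xk that k unfolding fine_def by blast
        then show ?thesis
          using gd[of x y] that lr by (auto simp: dist_real_def abs_minus_commute[of y x])
      qed
      have "integral {a..l} (\<lambda>u. f' u * g u) + integral {l..r} (\<lambda>u. f' u * g u) = integral {a..r} (\<lambda>u. f' u * g u)"
        using lr by (intro Henstock_Kurzweil_Integration.integral_combine int) auto
      then have \<Phi>: "\<Phi> r - \<Phi> l = f r * g r - f l * g l - integral {l..r} (\<lambda>u. f' u * g u)"
        by (simp add: \<Phi>_def)
      have "integral {l..r} (\<lambda>u. f' u * g u) - g x * (f r - f l) = integral {l..r} (\<lambda>u. f' u * (g u - g x))"
        using int lr by (simp add: right_diff_distrib integral_diff FTC mult.commute integrable_on_mult_left)
      also have "norm \<dots> \<le> integral {l..r} (\<lambda>u. f' u * e)"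
      proof (rule integral_norm_bound_integral)
        show "(\<lambda>u. f' u * (g u - g x)) integrable_on {l..r}"
          by (intro integrable_continuous_real continuous_intros continuous_on_subset[OF f'_cont]
              continuous_on_subset[OF g]) auto
        show "norm (f' u * (g u - g x)) \<le> f' u * e" if "u \<in> {l..r}" for u
          using gx[OF that] f'_pos[of u] by (simp add: abs_mult mult_left_mono)
      qed (use int in \<open>auto intro: integrable_on_mult_left\<close>)
      also have "\<dots> = e * (f r - f l)" using lr by (simp add: FTC)
      finally have i1: "\<bar>integral {l..r} (\<lambda>u. f' u * g u) - g x * (f r - f l)\<bar> \<le> e * (f r - f l)" by simp
      have "\<bar>(f r - f x) * (g r - g x)\<bar> \<le> (f r - f x) * e"
        using gx[of r] lr f_mono[of x r] by (simp add: abs_mult mult_left_mono)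
      moreover have "\<bar>(f x - f l) * (g l - g x)\<bar> \<le> (f x - f l) * e"
        using gx[of l] lr f_mono[of l x] by (simp add: abs_mult mult_left_mono)
      \<comment> \<open>Three errors from replacing g by its value at the tag x: inside the
        integral, at the right end and at the left end of the cell.\<close>
      moreover have "f x * (g r - g l) - (\<Phi> r - \<Phi> l) =
          (integral {l..r} (\<lambda>u. f' u * g u) - g x * (f r - f l)) - (f r - f x) * (g r - g x) - (f x - f l) * (g l - g x)"
        unfolding \<Phi> by (simp add: algebra_simps)
      ultimately have "\<bar>f x * (g r - g l) - (\<Phi> r - \<Phi> l)\<bar> \<le> e * (f r - f l) + (f r - f x) * e + (f x - f l) * e"
        using i1 by linarith
      also have "\<dots> = 2 * e * (f r - f l)" by (simp add: algebra_simps)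
      finally show ?thesis using k lr by simp
    qed
    have add: "(\<Sum>(x, k)\<in>p. F (Sup k) - F (Inf k)) = F b - F a" for F :: "real \<Rightarrow> real"
      using ab by (intro additive_tagged_division_1[OF _ p]) simp
    have "\<bar>(\<Sum>(x, k)\<in>p. f x * (g (Sup k) - g (Inf k))) - (\<Phi> b - \<Phi> a)\<bar>
        = \<bar>\<Sum>(x, k)\<in>p. f x * (g (Sup k) - g (Inf k)) - (\<Phi> (Sup k) - \<Phi> (Inf k))\<bar>"
      unfolding add[of \<Phi>, symmetric] by (simp add: sum_subtractf case_prod_unfold)
    also have "\<dots> \<le> (\<Sum>(x, k)\<in>p. 2 * e * (f (Sup k) - f (Inf k)))"
      using bound by (intro sum_abs[THEN order_trans] sum_mono) auto
    also have "\<dots> = 2 * e * (f b - f a)"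
      unfolding add[of f, symmetric] by (simp add: sum_distrib_left case_prod_unfold)
    finally show ?thesis using 1 by linarith
  qed
  then have *: "\<bar>J - (\<Phi> b - \<Phi> a)\<bar> \<le> e * (2 * (f b - f a) + 1)" if "e > 0" for e
    using that by (simp add: algebra_simps)
  have K: "2 * (f b - f a) + 1 > 0" using f_mono[of a b] ab by simp
  have le: "\<bar>J - (\<Phi> b - \<Phi> a)\<bar> \<le> 0 + e" if "e > 0" for e
    \<comment> \<open>Rescaling e absorbs the constant; the summand 1 keeps it positive when f is
      constant on [a, b].\<close>
    using *[of "e / (2 * (f b - f a) + 1)"] K that by simp
  have "\<bar>J - (\<Phi> b - \<Phi> a)\<bar> \<le> 0"
    by (rule field_le_epsilon) (rule le)
  then have "J = \<Phi> b - \<Phi> a"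
    unfolding abs_le_zero_iff by (simp only: right_minus_eq)
  then show ?thesis by (simp add: \<Phi>_def)
qed

section \<open>The exponential law\<close>

abbreviation exp_law :: "real \<Rightarrow> real measure" where
  "exp_law \<beta> \<equiv> density lborel (\<lambda>x. ennreal (exponential_density \<beta> x))"

text \<open>Pointwise facts about power increments are needed for strictly positive lags only; the
  lag 0 is a null set.\<close>

lemma AE_exp_law_pos:
  assumes "\<beta> > 0" shows "AE v in exp_law \<beta>. v > 0"
  using assms AE_lborel_singleton[of 0]
  by (subst AE_density) (auto simp: erlang_density_def elim: eventually_mono)

lemma exp_law_integral:
  assumes [measurable]: "f \<in> borel_measurable borel" and "\<beta> > 0"
  shows "(\<integral>v. f v \<partial>exp_law \<beta>) = (LINT v:{0..}|lborel. \<beta> * exp (- \<beta> * v) * f v)"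
    and "integrable (exp_law \<beta>) f \<longleftrightarrow> set_integrable lborel {0..} (\<lambda>v. \<beta> * exp (- \<beta> * v) * f v)"
proof -
  have *: "exponential_density \<beta> v *\<^sub>R f v = indicator {0..} v *\<^sub>R (\<beta> * exp (- \<beta> * v) * f v)" for v
    by (auto simp: exponential_density_def indicator_def mult.commute)
  show "(\<integral>v. f v \<partial>exp_law \<beta>) = (LINT v:{0..}|lborel. \<beta> * exp (- \<beta> * v) * f v)"
    using assms unfolding set_lebesgue_integral_def *[symmetric]
    by (intro integral_density) auto
  show "integrable (exp_law \<beta>) f \<longleftrightarrow> set_integrable lborel {0..} (\<lambda>v. \<beta> * exp (- \<beta> * v) * f v)"
    using assms unfolding set_integrable_def *[symmetric]
    by (intro integrable_density) auto
qed

lemma exp_law_integral_shift: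
  assumes [measurable]: "f \<in> borel_measurable borel" and "\<beta> > 0"
  shows "(\<integral>v. f (t - v) \<partial>exp_law \<beta>) = (LINT u:{..t}|lborel. \<beta> * exp (- \<beta> * (t - u)) * f u)"
    and "integrable (exp_law \<beta>) (\<lambda>v. f (t - v)) \<longleftrightarrow>
      set_integrable lborel {..t} (\<lambda>u. \<beta> * exp (- \<beta> * (t - u)) * f u)"
proof -
  have [simp]: "indicator {..t} (t - v) = (indicator {0..} v :: real)" for v
    by (auto simp: indicator_def)
  show "(\<integral>v. f (t - v) \<partial>exp_law \<beta>) = (LINT u:{..t}|lborel. \<beta> * exp (- \<beta> * (t - u)) * f u)"
    unfolding set_lebesgue_integral_def
    by (subst lborel_integral_real_affine[where c = "-1" and t = t])
      (simp_all add: exp_law_integral(1) assms(2) set_lebesgue_integral_def)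
  show "integrable (exp_law \<beta>) (\<lambda>v. f (t - v)) \<longleftrightarrow>
      set_integrable lborel {..t} (\<lambda>u. \<beta> * exp (- \<beta> * (t - u)) * f u)"
    unfolding set_integrable_def
    by (subst lborel_integrable_real_affine_iff[where c = "-1" and t = t, symmetric])
      (simp_all add: exp_law_integral(2) assms(2) set_integrable_def)
qed

lemma exp_law_integrable_power:
  assumes "\<beta> > 0" shows "integrable (exp_law \<beta>) (\<lambda>v. v ^ n)"
proof -
  interpret prob_space "exp_law \<beta>"
    using assms by (rule prob_space_exponential_density)
  have "distributed (exp_law \<beta>) lborel (\<lambda>v. v) (exponential_density \<beta>)"
    by (simp add: distributed_def distr_id2)
  then show ?thesis
    using erlang_ith_moment_integrable[OF assms] by simp
qed

text \<open>The form in which all integrability over lags is obtained: exponential laws have moments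
  of every order, and the offset a accommodates bounds in 1 + |t| + w + v and the like.\<close>

lemma exp_law_integrable_bound:
  fixes f :: "real \<Rightarrow> real"
  assumes "\<beta> > 0" and [measurable]: "f \<in> borel_measurable borel"
    and bound: "\<And>v. v \<ge> 0 \<Longrightarrow> \<bar>f v\<bar> \<le> C * (a + v) ^ n"
  shows "integrable (exp_law \<beta>) f"
proof (rule Bochner_Integration.integrable_bound)
  have "integrable (exp_law \<beta>) (\<lambda>v. C * (\<Sum>k\<le>n. of_nat (n choose k) * a ^ k * v ^ (n - k)))"
    by (intro integrable_mult_right Bochner_Integration.integrable_sum exp_law_integrable_power assms)
  then show "integrable (exp_law \<beta>) (\<lambda>v. C * (a + v) ^ n)"
    by (simp add: binomial_ring)
  show "AE v in exp_law \<beta>. norm (f v) \<le> norm (C * (a + v) ^ n)"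
    using AE_exp_law_pos[OF assms(1)]
    by eventually_elim (auto intro: order_trans[OF bound])
qed simp

section \<open>The kernel of the covariance\<close>

text \<open>Replaces real exponents below 2 by polynomial growth; the 1 is needed because x^r
  exceeds x^n for x < 1 and r < n.\<close>

lemma powr_le_power: "x powr r \<le> (1 + x) ^ n" if "x \<ge> 0" "r \<ge> 0" "r \<le> real n" for x r :: real
proof -
  have "x powr r \<le> (1 + x) powr r" using that by (intro powr_mono2) auto
  also have "\<dots> \<le> (1 + x) powr real n" using that by (intro powr_mono) auto
  also have "\<dots> = (1 + x) ^ n" using that by (intro powr_realpow) auto
  finally show ?thesis .
qed

text \<open>The increment of x^r over [u, u + w]. It occurs with r = H, where it is an increment of
  the covariance kernel, and with r = H - 1, from differentiating in u.\<close>

definition pinc :: "real \<Rightarrow> real \<Rightarrow> real \<Rightarrow> real" where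
  "pinc r w u = (u + w) powr r - u powr r"

lemma pinc_measurable[measurable]:
  "f \<in> borel_measurable N \<Longrightarrow> g \<in> borel_measurable N \<Longrightarrow> (\<lambda>x. pinc r (f x) (g x)) \<in> borel_measurable N"
  unfolding pinc_def
  by (intro borel_measurable_diff borel_measurable_add powr_real_measurable borel_measurable_const)

lemma continuous_on_pinc: "r > 0 \<Longrightarrow> w \<ge> 0 \<Longrightarrow> continuous_on {0..} (pinc r w)"
  unfolding pinc_def by (intro continuous_on_diff continuous_on_powr' continuous_intros) auto

lemma pinc_bounds:
  assumes "r > 0" "r \<le> 2" "w \<ge> 0" "0 \<le> u" "u \<le> s"
  shows "0 \<le> pinc r w u" "pinc r w u \<le> (1 + s + w)\<^sup>2"
proof -
  show "0 \<le> pinc r w u"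
    using assms unfolding pinc_def by (simp add: powr_mono2)
  have "pinc r w u \<le> (u + w) powr r" by (simp add: pinc_def)
  also have "\<dots> \<le> (1 + (u + w))\<^sup>2" using assms by (intro powr_le_power) auto
  also have "\<dots> \<le> (1 + s + w)\<^sup>2" using assms by (intro power_mono) auto
  finally show "pinc r w u \<le> (1 + s + w)\<^sup>2" .
qed

lemma DERIV_pinc_u:
  assumes "u > 0" "w \<ge> 0"
  shows "(pinc r w has_real_derivative r * pinc (r - 1) w u) (at u)"
  unfolding pinc_def using assms
  by (auto intro!: derivative_eq_intros simp: algebra_simps)

lemma DERIV_pinc_w:
  assumes "u + w > 0"
  shows "((\<lambda>w. pinc r w u) has_real_derivative r * (u + w) powr (r - 1)) (at w)"
  unfolding pinc_def using assms by (auto intro!: derivative_eq_intros)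

text \<open>The quotient is the integral of (u + z)^(r-1) over z in [0, w]: positive whatever the
  sign of r, and at most w u^(r-1) since the integrand decreases for r < 1. The mean value theorem
  replaces the integral.\<close>

lemma pinc_quotient_bounds:
  assumes "r < 1" "r \<noteq> 0" "u > 0" "w > 0"
  shows "0 < pinc r w u / r" "pinc r w u / r \<le> w * u powr (r - 1)"
proof -
  have "\<exists>z. 0 < z \<and> z < w \<and> pinc r w u - pinc r 0 u = (w - 0) * (r * (u + z) powr (r - 1))"
    using assms by (intro MVT2 DERIV_pinc_w) auto
  then obtain z where z: "0 < z" "z < w" "pinc r w u = w * (r * (u + z) powr (r - 1))"
    by (auto simp: pinc_def)
  then have *: "pinc r w u / r = w * (u + z) powr (r - 1)"
    using assms by simp
  show "0 < pinc r w u / r"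
    unfolding * using assms z by simp
  have "(u + z) powr (r - 1) \<le> u powr (r - 1)"
    using assms z by (intro powr_mono2') auto
  then show "pinc r w u / r \<le> w * u powr (r - 1)"
    unfolding * using assms z by (intro mult_left_mono) auto
qed

text \<open>After the substitution u = t - v, e^(\<beta> t) times the average of F(t - v) is the
  integral of \<beta> e^(\<beta> u) F(u) over u \<le> t, with an integrand free of t. In the
  difference between t = s and t = 0 the integral over u < 0 cancels, so only the values of F on
  [0, s] remain.\<close>

lemma exp_law_increment_transform:
  fixes F :: "real \<Rightarrow> real"
  assumes F: "continuous_on UNIV F" and \<beta>: "\<beta> > 0" and s: "s \<ge> 0"
    and int: "\<And>t. integrable (exp_law \<beta>) (\<lambda>v. F (t - v))"
  shows "exp (\<beta> * s) * (\<integral>v. F s - F (s - v) \<partial>exp_law \<beta>) - (\<integral>v. F 0 - F (0 - v) \<partial>exp_law \<beta>) =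
    exp (\<beta> * s) * F s - F 0 - \<beta> * (LINT u:{0..s}|lborel. exp (\<beta> * u) * F u)"
proof -
  interpret prob_space "exp_law \<beta>"
    using \<beta> by (rule prob_space_exponential_density)
  have [measurable]: "F \<in> borel_measurable borel"
    using F by (rule borel_measurable_continuous_onI)
  have e: "exp (\<beta> * t) * (\<beta> * exp (- \<beta> * (t - u)) * F u) = \<beta> * exp (\<beta> * u) * F u" for t u
    by (simp add: algebra_simps flip: exp_add)
  have K: "exp (\<beta> * t) * (\<integral>v. F (t - v) \<partial>exp_law \<beta>) = (LINT u:{..t}|lborel. \<beta> * exp (\<beta> * u) * F u)" for t
  proof -
    have "(\<integral>v. F (t - v) \<partial>exp_law \<beta>) = (LINT u:{..t}|lborel. \<beta> * exp (- \<beta> * (t - u)) * F u)"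
      using \<beta> by (intro exp_law_integral_shift(1)) auto
    then show ?thesis
      by (simp only: set_integral_mult_right[symmetric] e)
  qed
  have Ki: "set_integrable lborel {..t} (\<lambda>u. \<beta> * exp (\<beta> * u) * F u)" for t
    using set_integrable_mult_right[of "exp (\<beta> * t)" lborel "{..t}" "\<lambda>u. \<beta> * exp (- \<beta> * (t - u)) * F u"]
      exp_law_integral_shift(2)[OF _ \<beta>, of F t] int[of t] by (simp only: e) simp
  have "(LINT u:{..s}|lborel. \<beta> * exp (\<beta> * u) * F u)
      = (LINT u:{..<0} \<union> {0..s}|lborel. \<beta> * exp (\<beta> * u) * F u)"
    using s by (intro arg_cong[where f = "\<lambda>A. set_lebesgue_integral lborel A _"]) auto
  also have "\<dots> = (LINT u:{..<0}|lborel. \<beta> * exp (\<beta> * u) * F u) + (LINT u:{0..s}|lborel. \<beta> * exp (\<beta> * u) * F u)"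
    by (intro set_integral_Un set_integrable_subset[OF Ki[of s]]) (use s in auto)
  also have "(LINT u:{..<0}|lborel. \<beta> * exp (\<beta> * u) * F u) = (LINT u:{..0}|lborel. \<beta> * exp (\<beta> * u) * F u)"
    by (intro set_integral_discrete_difference[where X = "{0}"]) auto
  also have "(LINT u:{0..s}|lborel. \<beta> * exp (\<beta> * u) * F u) = \<beta> * (LINT u:{0..s}|lborel. exp (\<beta> * u) * F u)"
    by (simp add: mult.assoc)
  finally have K': "exp (\<beta> * s) * (\<integral>v. F (s - v) \<partial>exp_law \<beta>) = exp (\<beta> * 0) * (\<integral>v. F (0 - v) \<partial>exp_law \<beta>)
      + \<beta> * (LINT u:{0..s}|lborel. exp (\<beta> * u) * F u)"
    unfolding K .
  have E: "(\<integral>v. F t - F (t - v) \<partial>exp_law \<beta>) = F t - (\<integral>v. F (t - v) \<partial>exp_law \<beta>)" for t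
    using int[of t] prob_space by simp
  show ?thesis
    using K' unfolding E by (simp add: right_diff_distrib)
qed

text \<open>Integration by parts in w: the w-derivative of \<open>pinc r w u / r\<close> is (u +
  w)^(r-1), and integrating against the density \<beta> e^(-\<beta> w) transfers the derivative. The
  reflection v = -w then produces the inner integral of \<open>I_coef\<close>.\<close>

lemma exp_law_pinc:
  assumes \<beta>: "\<beta> > 0" and r: "r < 1" "r \<noteq> 0" and u: "u > 0"
  shows "(\<integral>w. pinc r w u / r \<partial>exp_law \<beta>) = (LINT v:{..0}|lborel. exp (\<beta> * v) * (u - v) powr (r - 1))"
    and "integrable (exp_law \<beta>) (\<lambda>w. pinc r w u / r)"
proof -
  interpret prob_space "exp_law \<beta>"
    using \<beta> by (rule prob_space_exponential_density)
  have [measurable]: "(\<lambda>w. pinc r w u / r) \<in> borel_measurable borel" by measurable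
  have [measurable]: "(\<lambda>w. (u + w) powr (r - 1)) \<in> borel_measurable borel"
    "(\<lambda>w. (u - w) powr (r - 1)) \<in> borel_measurable borel"
    by (intro powr_real_measurable borel_measurable_add borel_measurable_diff borel_measurable_const
        measurable_ident_sets refl)+
  have pos: "0 \<le> pinc r w u / r" "pinc r w u / r \<le> w * u powr (r - 1)" if "w \<ge> 0" for w
    using pinc_quotient_bounds[OF r u, of w] that by (cases "w = 0"; simp add: pinc_def)+
  show int: "integrable (exp_law \<beta>) (\<lambda>w. pinc r w u / r)"
  proof (rule exp_law_integrable_bound[OF \<beta>])
    show "\<bar>pinc r v u / r\<bar> \<le> u powr (r - 1) * (0 + v) ^ 1" if "v \<ge> 0" for v
      using pos[OF that] by (simp only: abs_of_nonneg) (simp add: mult.commute)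
  qed simp
  have int': "integrable (exp_law \<beta>) (\<lambda>w. (u + w) powr (r - 1))"
  proof (rule exp_law_integrable_bound[OF \<beta>])
    show "\<bar>(u + v) powr (r - 1)\<bar> \<le> u powr (r - 1) * (0 + v) ^ 0" if "v \<ge> 0" for v
      using r u that by (auto intro!: powr_mono2')
  qed simp
  let ?f = "\<lambda>w. \<beta> * (exp (- \<beta> * w) * (pinc r w u / r)) - exp (- \<beta> * w) * (u + w) powr (r - 1)"
  \<comment> \<open>\<open>?f\<close> is the derivative of \<open>?F\<close> and also the difference
    of the two integrands to be compared. \<open>?F\<close> vanishes at w = 0 and at infinity, so
    \<open>?f\<close> has integral 0.\<close>
  let ?F = "\<lambda>w. - (exp (- \<beta> * w) * (pinc r w u / r))"
  have i1: "set_integrable lborel {0..} (\<lambda>w. \<beta> * (exp (- \<beta> * w) * (pinc r w u / r)))"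
    using exp_law_integral(2)[OF _ \<beta>, of "\<lambda>w. pinc r w u / r"] int by (simp only: mult.assoc) simp
  have i2: "set_integrable lborel {0..} (\<lambda>w. exp (- \<beta> * w) * (u + w) powr (r - 1))"
    using set_integrable_mult_right[of "1 / \<beta>" lborel "{0..}" "\<lambda>w. \<beta> * exp (- \<beta> * w) * (u + w) powr (r - 1)"]
      exp_law_integral(2)[OF _ \<beta>, of "\<lambda>w. (u + w) powr (r - 1)"] int' \<beta> by simp
  have i: "set_integrable lborel {0..} ?f"
    using i1 i2 by (rule set_integral_diff)
  have "(LBINT w=ereal 0..\<infinity>. ?f w) = 0 - ?F 0"
  proof (rule interval_integral_FTC_integrable)
    show "(?F has_vector_derivative ?f x) (at x)" if "ereal 0 < ereal x" for x
      unfolding has_real_derivative_iff_has_vector_derivative[symmetric]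
      using that u r by (auto intro!: derivative_eq_intros DERIV_pinc_w simp: field_simps)
    show "isCont ?f x" if "ereal 0 < ereal x" for x
      unfolding pinc_def using that u r by (intro continuous_intros) auto
    show "set_integrable lborel (einterval (ereal 0) \<infinity>) ?f"
      by (rule set_integrable_subset[OF i]) (auto simp: einterval_iff)
    have "isCont ?F 0"
      unfolding pinc_def using u r by (intro continuous_intros) auto
    then show "((?F \<circ> real_of_ereal) \<longlongrightarrow> ?F 0) (at_right (ereal 0))"
      unfolding ereal_tendsto_simps by (simp only: isCont_def filterlim_at_split)
    have "(?F \<longlongrightarrow> 0) at_top"
    proof (rule tendsto_rabs_zero_cancel, rule tendsto_sandwich[OF _ _ tendsto_const])
      have "((\<lambda>w. (\<beta> * w) / exp (\<beta> * w)) \<longlongrightarrow> 0) at_top"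
        using tendsto_power_div_exp_0[of 1] filterlim_tendsto_pos_mult_at_top[OF tendsto_const \<beta> filterlim_ident]
        by (auto intro: filterlim_compose)
      then have "((\<lambda>w. (u powr (r - 1) / \<beta>) * ((\<beta> * w) / exp (\<beta> * w))) \<longlongrightarrow> (u powr (r - 1) / \<beta>) * 0) at_top"
        by (intro tendsto_mult tendsto_const)
      then show "((\<lambda>w. (u powr (r - 1) / \<beta>) * ((\<beta> * w) / exp (\<beta> * w))) \<longlongrightarrow> 0) at_top" by simp
      show "\<forall>\<^sub>F w in at_top. \<bar>?F w\<bar> \<le> (u powr (r - 1) / \<beta>) * ((\<beta> * w) / exp (\<beta> * w))"
        using eventually_ge_at_top[of 0]
      proof eventually_elim
        case (elim w)
        have "\<bar>?F w\<bar> = exp (- \<beta> * w) * (pinc r w u / r)"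
          using pos[OF elim] by (simp only: abs_minus_cancel abs_mult abs_of_nonneg exp_ge_zero)
        also have "\<dots> \<le> exp (- \<beta> * w) * (w * u powr (r - 1))"
          by (intro mult_left_mono pos elim) simp
        also have "\<dots> = (u powr (r - 1) / \<beta>) * ((\<beta> * w) / exp (\<beta> * w))"
          using \<beta> by (simp add: exp_minus field_simps)
        finally show ?case .
      qed
    qed simp
    then show "((?F \<circ> real_of_ereal) \<longlongrightarrow> 0) (at_left \<infinity>)"
      unfolding ereal_tendsto_simps .
  qed simp
  also have "\<dots> = 0" by (simp add: pinc_def)
  also have "(LBINT w=ereal 0..\<infinity>. ?f w) = (LINT w:{0<..}|lborel. ?f w)"
    by (rule interval_integral_to_infinity_eq)
  also have "\<dots> = (LINT w:{0..}|lborel. ?f w)"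
    by (rule set_integral_discrete_difference[where X = "{0}"]) auto
  also have "\<dots> = (LINT w:{0..}|lborel. \<beta> * (exp (- \<beta> * w) * (pinc r w u / r)))
      - (LINT w:{0..}|lborel. exp (- \<beta> * w) * (u + w) powr (r - 1))"
    using i1 i2 by (rule set_integral_diff)
  also have "(LINT w:{0..}|lborel. \<beta> * (exp (- \<beta> * w) * (pinc r w u / r))) = (\<integral>w. pinc r w u / r \<partial>exp_law \<beta>)"
    using exp_law_integral(1)[OF _ \<beta>, of "\<lambda>w. pinc r w u / r", symmetric] by (simp add: mult.assoc)
  also have "(LINT w:{0..}|lborel. exp (- \<beta> * w) * (u + w) powr (r - 1))
      = 1 / \<beta> * (\<integral>w. (u + w) powr (r - 1) \<partial>exp_law \<beta>)"
    using exp_law_integral(1)[OF _ \<beta>, of "\<lambda>w. (u + w) powr (r - 1)"] \<beta> by (simp add: mult.assoc)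
  also have "(\<integral>w. (u + w) powr (r - 1) \<partial>exp_law \<beta>) = (LINT v:{..0}|lborel. \<beta> * exp (- \<beta> * (0 - v)) * (u - v) powr (r - 1))"
    using exp_law_integral_shift(1)[OF _ \<beta>, of "\<lambda>v. (u - v) powr (r - 1)" 0] by simp
  also have "1 / \<beta> * \<dots> = (LINT v:{..0}|lborel. exp (\<beta> * v) * (u - v) powr (r - 1))"
    using \<beta> by (simp add: mult.assoc)
  finally show "(\<integral>w. pinc r w u / r \<partial>exp_law \<beta>) = (LINT v:{..0}|lborel. exp (\<beta> * v) * (u - v) powr (r - 1))"
    by simp
qed

text \<open>The right-hand side of \<open>exp_law_increment_transform\<close> for F =
  \<open>pinc H w\<close>. By parts it is the integral of e^(\<alpha> u) F'(u) over [0, s]; the form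
  chosen here avoids F', which is unbounded near 0 for H < 1.\<close>

definition kernel_int :: "real \<Rightarrow> real \<Rightarrow> real \<Rightarrow> real \<Rightarrow> real" where
  "kernel_int H \<alpha> s w = exp (\<alpha> * s) * pinc H w s - pinc H w 0
     - \<alpha> * (LINT u:{0..s}|lborel. exp (\<alpha> * u) * pinc H w u)"

lemma kernel_int_measurable[measurable]: "kernel_int H \<alpha> s \<in> borel_measurable borel"
proof -
  have "(\<lambda>w. kernel_int H \<alpha> s w) \<in> borel_measurable borel"
    unfolding kernel_int_def set_lebesgue_integral_def by measurable
  then show ?thesis by simp
qed

text \<open>For H < 1 the integrand is unbounded at u = 0, while the primitive F is continuous on
  [0, s]. The fundamental theorem for nonnegative integrands on an open interval then gives
  integrability along with the value; division by H (H - 1) is what makes the integrand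
  nonnegative.\<close>

lemma kernel_int_FTC:
  assumes H: "0 < H" "H < 2" "H \<noteq> 1" and s: "s > 0" and w: "w > 0"
  shows "set_integrable lborel {0<..<s} (\<lambda>u. exp (\<alpha> * u) * (pinc (H - 1) w u / (H - 1)))"
    and "(LINT u:{0<..<s}|lborel. exp (\<alpha> * u) * (pinc (H - 1) w u / (H - 1))) =
      kernel_int H \<alpha> s w / (H * (H - 1))"
proof -
  let ?f = "\<lambda>u. exp (\<alpha> * u) * (pinc (H - 1) w u / (H - 1))"
  let ?h = "\<lambda>u. exp (\<alpha> * u) * pinc H w u"
  define F where "F u = (?h u - \<alpha> * integral {0..u} ?h) / (H * (H - 1))" for u
  have hc: "continuous_on {0..s} ?h"
    using H w by (intro continuous_intros continuous_on_subset[OF continuous_on_pinc]) auto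
  have Fc: "continuous_on {0..s} F"
    unfolding F_def using H
    by (intro continuous_on_divide continuous_on_diff hc continuous_on_mult continuous_on_const
        indefinite_integral_continuous_1 integrable_continuous_real) auto
  have D: "DERIV F x :> ?f x" if "ereal 0 < ereal x" "ereal x < ereal s" for x
  proof -
    have x: "0 < x" "x < s" using that by auto
    have "((\<lambda>u. integral {0..u} ?h) has_real_derivative ?h x) (at x within {0..s})"
      using x by (intro integral_has_real_derivative[OF hc]) auto
    then have "((\<lambda>u. integral {0..u} ?h) has_real_derivative ?h x) (at x)"
      using x by (simp add: at_within_Icc_at)
    then have "((\<lambda>u. ?h u - \<alpha> * integral {0..u} ?h) has_real_derivative
        \<alpha> * exp (\<alpha> * x) * pinc H w x + exp (\<alpha> * x) * (H * pinc (H - 1) w x) - \<alpha> * ?h x) (at x)"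
      using x w by (auto intro!: derivative_eq_intros DERIV_pinc_u simp: algebra_simps)
    then have "(F has_real_derivative
        (\<alpha> * exp (\<alpha> * x) * pinc H w x + exp (\<alpha> * x) * (H * pinc (H - 1) w x) - \<alpha> * ?h x) / (H * (H - 1))) (at x)"
      unfolding F_def by (rule DERIV_cdivide)
    moreover have "(\<alpha> * exp (\<alpha> * x) * pinc H w x + exp (\<alpha> * x) * (H * pinc (H - 1) w x) - \<alpha> * ?h x) / (H * (H - 1)) = ?f x"
      using H by (simp add: field_simps)
    ultimately show ?thesis by simp
  qed
  have c: "isCont ?f x" if "ereal 0 < ereal x" "ereal x < ereal s" for x
    unfolding pinc_def using that w H by (intro continuous_intros) auto
  have nn: "AE x in lborel. ereal 0 < ereal x \<longrightarrow> ereal x < ereal s \<longrightarrow> 0 \<le> ?f x"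
  proof (intro AE_I2 impI)
    fix x assume "ereal 0 < ereal x" "ereal x < ereal s"
    then have "0 < pinc (H - 1) w x / (H - 1)"
      using H w by (intro pinc_quotient_bounds(1)) auto
    then show "0 \<le> ?f x"
      by (intro mult_nonneg_nonneg less_imp_le[OF \<open>0 < pinc (H - 1) w x / (H - 1)\<close>] exp_ge_zero)
  qed
  have A: "((F \<circ> real_of_ereal) \<longlongrightarrow> F 0) (at_right (ereal 0))"
    unfolding ereal_tendsto_simps using Fc s by (rule continuous_on_Icc_at_rightD)
  have B: "((F \<circ> real_of_ereal) \<longlongrightarrow> F s) (at_left (ereal s))"
    unfolding ereal_tendsto_simps using Fc s by (rule continuous_on_Icc_at_leftD)
  have s': "ereal 0 < ereal s" using s by simp
  note FTC = interval_integral_FTC_nonneg[OF s' D c nn A B]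
  show "set_integrable lborel {0<..<s} ?f"
    using FTC(1) by simp
  have "(LINT u:{0<..<s}|lborel. ?f u) = F s - F 0"
    using FTC(2) s by (simp add: interval_integral_Ioo)
  also have "integral {0..s} ?h = (LINT u:{0..s}|lborel. ?h u)"
    using borel_integrable_compact[OF _ hc] by (intro set_borel_integral_eq_integral(2)[symmetric]) (simp add: set_integrable_def)
  then have "F s - F 0 = kernel_int H \<alpha> s w / (H * (H - 1))"
    by (simp add: F_def kernel_int_def diff_divide_distrib)
  finally show "(LINT u:{0<..<s}|lborel. ?f u) = kernel_int H \<alpha> s w / (H * (H - 1))" .
qed

text \<open>Polynomial growth in w, for integrability under the exponential law. The two endpoint
  terms and the integral contribute 1, 1 and \<alpha> s times e^(\<alpha> s) (1 + s + w)^2.\<close>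

lemma kernel_int_bound:
  assumes H: "0 < H" "H < 2" and s: "s > 0" and w: "w \<ge> 0" and \<alpha>: "\<alpha> > 0"
  shows "\<bar>kernel_int H \<alpha> s w\<bar> \<le> (exp (\<alpha> * s) * (2 + \<alpha> * s)) * ((1 + s) + w)\<^sup>2"
proof -
  let ?h = "\<lambda>u. exp (\<alpha> * u) * pinc H w u"
  let ?c = "exp (\<alpha> * s) * (1 + s + w)\<^sup>2"
  have b: "0 \<le> ?h u" "?h u \<le> ?c" if "u \<in> {0..s}" for u
    using pinc_bounds[of H w u s] H w that \<alpha> by (auto intro!: mult_mono mult_nonneg_nonneg)
  have "continuous_on {0..s} ?h"
    using H w by (intro continuous_intros continuous_on_subset[OF continuous_on_pinc]) auto
  then have i: "set_integrable lborel {0..s} ?h"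
    using borel_integrable_compact[of "{0..s}" ?h] by (simp add: set_integrable_def)
  have "set_integrable lborel {0..s} (\<lambda>_. ?c)"
    unfolding set_integrable_def real_scaleR_def
    by (intro integrable_mult_left integrable_real_indicator) (auto simp: emeasure_lborel_Icc_eq)
  then have "(LINT u:{0..s}|lborel. ?h u) \<le> (LINT u:{0..s}|lborel. ?c)"
    using i b(2) by (intro set_integral_mono)
  then have "(LINT u:{0..s}|lborel. ?h u) \<le> s * ?c" using s by (simp add: set_lebesgue_integral_def mult_ac)
  moreover have "0 \<le> (LINT u:{0..s}|lborel. ?h u)"
    using b(1) unfolding set_lebesgue_integral_def
    by (intro integral_nonneg_AE AE_I2) (auto simp: indicator_def)
  ultimately have 1: "0 \<le> \<alpha> * (LINT u:{0..s}|lborel. ?h u)" "\<alpha> * (LINT u:{0..s}|lborel. ?h u) \<le> \<alpha> * (s * ?c)"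
    using \<alpha> by (auto intro: mult_left_mono)
  have "\<bar>kernel_int H \<alpha> s w\<bar> \<le> ?h s + ?h 0 + \<alpha> * (LINT u:{0..s}|lborel. ?h u)"
    using b[of s] b[of 0] 1 s unfolding kernel_int_def by (simp add: abs_le_iff)
  also have "\<dots> \<le> ?c + ?c + \<alpha> * (s * ?c)"
    using b[of s] b[of 0] 1 s by (intro add_mono) auto
  also have "\<dots> = (exp (\<alpha> * s) * (2 + \<alpha> * s)) * ((1 + s) + w)\<^sup>2"
    by (simp add: algebra_simps)
  finally show ?thesis .
qed

text \<open>Fubini for \<open>exp (\<alpha> * u) * pinc (H - 1) w u / (H - 1)\<close>: integrating
  over u first gives \<open>kernel_int\<close>, averaging over w first gives the inner integral of
  I. The integrand is positive on the relevant domain, hence I > 0, so the estimators do not divide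
  by 0.\<close>

lemma kernel_int_integral:
  fixes H \<alpha> \<beta> s :: real
  assumes H: "0 < H" "H < 2" "H \<noteq> 1" and \<alpha>: "\<alpha> > 0" and \<beta>: "\<beta> > 0" and s: "s > 0"
  defines "I \<equiv> (LINT u:{0..s}|lborel. exp (\<alpha> * u) * (LINT v:{..0}|lborel. exp (\<beta> * v) * (u - v) powr (H - 2)))"
  shows "(\<integral>w. kernel_int H \<alpha> s w \<partial>exp_law \<beta>) = H * (H - 1) * I" and "I > 0"
proof -
  interpret P: prob_space "exp_law \<beta>"
    using \<beta> by (rule prob_space_exponential_density)
  interpret pair_sigma_finite "exp_law \<beta>" lborel ..
  define \<phi> where "\<phi> w u = pinc (H - 1) w u / (H - 1)" for w u
  define f where "f w u = indicator {0<..<s} u * (exp (\<alpha> * u) * \<phi> w u)" for w u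
  have \<phi>_pos: "\<phi> w u > 0" if "u > 0" "w > 0" for u w
    using pinc_quotient_bounds(1)[of "H - 1" u w] that H by (simp add: \<phi>_def)
  have [measurable]: "case_prod f \<in> borel_measurable (exp_law \<beta> \<Otimes>\<^sub>M lborel)"
    unfolding f_def \<phi>_def by measurable
  have f_u: "integrable lborel (f w)" "(\<integral>u. f w u \<partial>lborel) = kernel_int H \<alpha> s w / (H * (H - 1))" if "w > 0" for w
    using kernel_int_FTC[OF H s that, of \<alpha>] by (simp_all only: f_def[abs_def] \<phi>_def set_integrable_def set_lebesgue_integral_def real_scaleR_def)
  have f_nn: "f w u \<ge> 0" if "w > 0" for w u
    using \<phi>_pos[of u w] that by (auto simp: f_def indicator_def)
  have kmeas: "(\<lambda>w. \<integral>u. f w u \<partial>lborel) \<in> borel_measurable (exp_law \<beta>)"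
    by measurable
  have int1: "integrable (exp_law \<beta>) (\<lambda>w. \<integral>u. f w u \<partial>lborel)"
  proof (rule Bochner_Integration.integrable_bound)
    define C where "C = exp (\<alpha> * s) * (2 + \<alpha> * s) / \<bar>H * (H - 1)\<bar>"
    have "C \<ge> 0" unfolding C_def using \<alpha> s by simp
    show "integrable (exp_law \<beta>) (\<lambda>w. C * ((1 + s) + w)\<^sup>2)"
      by (rule exp_law_integrable_bound[OF \<beta>, where C = C and a = "1 + s" and n = 2])
        (use \<open>C \<ge> 0\<close> in \<open>auto simp: abs_mult\<close>)
    show "AE w in exp_law \<beta>. norm (\<integral>u. f w u \<partial>lborel) \<le> norm (C * ((1 + s) + w)\<^sup>2)"
      using AE_exp_law_pos[OF \<beta>]
    proof eventually_elim
      case (elim w)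
      have "norm (\<integral>u. f w u \<partial>lborel) = \<bar>kernel_int H \<alpha> s w\<bar> / \<bar>H * (H - 1)\<bar>"
        using elim by (simp add: f_u)
      also have "\<dots> \<le> (exp (\<alpha> * s) * (2 + \<alpha> * s)) * ((1 + s) + w)\<^sup>2 / \<bar>H * (H - 1)\<bar>"
        using kernel_int_bound[of H s w \<alpha>] H s \<alpha> elim by (intro divide_right_mono) auto
      also have "\<dots> = C * ((1 + s) + w)\<^sup>2" by (simp add: C_def)
      finally show ?case by simp
    qed
  qed (rule kmeas)
  have int: "integrable (exp_law \<beta> \<Otimes>\<^sub>M lborel) (case_prod f)"
  proof (rule Fubini_integrable)
    \<comment> \<open>By positivity the integral of the norm is the integral itself, whose
      polynomial bound in w is already known.\<close>
    have "integrable (exp_law \<beta>) (\<lambda>w. \<integral>u. norm (f w u) \<partial>lborel) \<longleftrightarrow> integrable (exp_law \<beta>) (\<lambda>w. \<integral>u. f w u \<partial>lborel)"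
    proof (rule integrable_cong_AE)
      show "AE w in exp_law \<beta>. (\<integral>u. norm (f w u) \<partial>lborel) = (\<integral>u. f w u \<partial>lborel)"
        using AE_exp_law_pos[OF \<beta>] by eventually_elim (simp add: f_nn)
    qed measurable
    then show "integrable (exp_law \<beta>) (\<lambda>w. \<integral>u. norm (case (w, u) of (w, u) \<Rightarrow> f w u) \<partial>lborel)"
      using int1 by simp
    show "AE w in exp_law \<beta>. integrable lborel (\<lambda>u. case (w, u) of (w, u) \<Rightarrow> f w u)"
      using AE_exp_law_pos[OF \<beta>] by eventually_elim (simp add: f_u)
  qed measurable
  define K where "K u = (\<integral>w. f w u \<partial>exp_law \<beta>)" for u
  have K: "K u = indicator {0<..<s} u * (exp (\<alpha> * u) * (\<integral>w. \<phi> w u \<partial>exp_law \<beta>))" for u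
    by (simp add: K_def f_def)
  have \<phi>_int: "(\<integral>w. \<phi> w u \<partial>exp_law \<beta>) = (LINT v:{..0}|lborel. exp (\<beta> * v) * (u - v) powr (H - 2))"
    and \<phi>_i: "integrable (exp_law \<beta>) (\<lambda>w. \<phi> w u)" if "u > 0" for u
    using exp_law_pinc[OF \<beta>, of "H - 1" u] that H by (simp_all add: \<phi>_def)
  have I: "I = (\<integral>u. K u \<partial>lborel)"
  proof -
    have "I = (LINT u:{0<..<s}|lborel. exp (\<alpha> * u) * (LINT v:{..0}|lborel. exp (\<beta> * v) * (u - v) powr (H - 2)))"
      unfolding I_def by (rule set_integral_discrete_difference[where X = "{0, s}"]) auto
    also have "\<dots> = (\<integral>u. K u \<partial>lborel)"
      unfolding set_lebesgue_integral_def[of lborel "{0<..<s}"]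
      by (intro Bochner_Integration.integral_cong refl) (simp add: K \<phi>_int indicator_def)
    finally show ?thesis .
  qed
  also have "\<dots> = (\<integral>w. (\<integral>u. f w u \<partial>lborel) \<partial>exp_law \<beta>)"
    unfolding K_def by (rule Fubini_integral[OF int])
  also have "\<dots> = (\<integral>w. kernel_int H \<alpha> s w / (H * (H - 1)) \<partial>exp_law \<beta>)"
  proof (rule integral_cong_AE)
    show "AE w in exp_law \<beta>. (\<integral>u. f w u \<partial>lborel) = kernel_int H \<alpha> s w / (H * (H - 1))"
      using AE_exp_law_pos[OF \<beta>] by eventually_elim (simp add: f_u)
  qed (use kmeas in simp_all)
  finally show "(\<integral>w. kernel_int H \<alpha> s w \<partial>exp_law \<beta>) = H * (H - 1) * I"
    using H by (simp add: field_simps)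
  have K_pos: "K u > 0" if "0 < u" "u < s" for u
  proof -
    have "AE w in exp_law \<beta>. 0 < \<phi> w u"
      using AE_exp_law_pos[OF \<beta>] by eventually_elim (rule \<phi>_pos[OF that(1)])
    then have "0 < (\<integral>w. \<phi> w u \<partial>exp_law \<beta>)"
      using P.integral_less_AE_space[of "\<lambda>_. 0" "\<lambda>w. \<phi> w u"] \<phi>_i[OF that(1)]
        P.emeasure_space_1 by simp
    then show ?thesis using that by (simp add: K)
  qed
  have Ki: "integrable lborel K"
    using integrable_snd[OF int] unfolding K_def by simp
  have K_nn: "K u \<ge> 0" for u
    using K_pos[of u] by (cases "0 < u \<and> u < s") (auto simp: K less_imp_le)
  have "I \<ge> 0" unfolding I by (intro Bochner_Integration.integral_nonneg K_nn)
  moreover have "I \<noteq> 0"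
  proof
    assume "I = 0"
    then have "AE u in lborel. K u = 0"
      using integral_nonneg_eq_0_iff_AE[OF Ki] K_nn by (simp add: I)
    then have "AE u in lborel. u \<notin> {0<..<s}"
      by eventually_elim (use K_pos in force)
    then have "emeasure lborel {0<..<s} = 0"
      by (subst AE_iff_measurable[of "{0<..<s}" lborel "\<lambda>u. u \<notin> {0<..<s}", symmetric]) auto
    then show False using s by simp
  qed
  ultimately show "I > 0" by simp
qed

text \<open>Integration by parts over [a, t], with g centered at g t so that the boundary term at t
  disappears, leaves only \<open>E a * q a\<close>. No growth bound on g at minus infinity is
  assumed; integrability of the increments under the exponential law takes its place.\<close>

lemma rs_integral_atMost_exp:
  fixes g :: "real \<Rightarrow> real"
  assumes g: "continuous_on UNIV g" and \<beta>: "\<beta> > 0"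
    and I: "has_rs_integral_atMost (\<lambda>u. exp (- \<beta> * (t - u))) g t I"
    and int: "integrable (exp_law \<beta>) (\<lambda>v. g t - g (t - v))"
  shows "I = (\<integral>v. g t - g (t - v) \<partial>exp_law \<beta>)"
proof -
  obtain J where J: "\<And>a. a < t \<Longrightarrow> has_rs_integral (\<lambda>u. exp (- \<beta> * (t - u))) g a t (J a)"
    and JI: "(J \<longlongrightarrow> I) at_bot"
    using I by (auto simp: has_rs_integral_atMost_def)
  define q where "q u = g t - g u" for u
  define E where "E u = exp (- \<beta> * (t - u))" for u
  have q_cont: "continuous_on UNIV q"
    unfolding q_def by (intro continuous_intros g)
  then have qm[measurable]: "q \<in> borel_measurable borel"
    by (rule borel_measurable_continuous_onI)
  have E_cont: "continuous_on A E" for A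
    unfolding E_def by (intro continuous_intros)
  have E': "(E has_real_derivative \<beta> * E x) (at x)" for x
    unfolding E_def by (auto intro!: derivative_eq_intros)
  have qi: "set_integrable lborel {..t} (\<lambda>u. \<beta> * E u * q u)"
    and qI: "(\<integral>v. g t - g (t - v) \<partial>exp_law \<beta>) = (LINT u:{..t}|lborel. \<beta> * E u * q u)"
    using exp_law_integral_shift[OF qm \<beta>, of t] int by (simp_all add: q_def[abs_def] E_def)
  have J_eq: "J a = E a * q a + (LINT u:{a..t}|lborel. \<beta> * E u * q u)" if a: "a < t" for a
  proof -
    have cont: "continuous_on {a..t} (\<lambda>u. \<beta> * E u)" "continuous_on {a..t} g" "continuous_on {a..t} q"
      by (intro continuous_intros E_cont continuous_on_subset[OF g] continuous_on_subset[OF q_cont]; simp)+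
    have "J a = E t * g t - E a * g a - integral {a..t} (\<lambda>u. \<beta> * E u * g u)"
    proof (rule rs_integral_by_parts[OF a E'])
      show "continuous_on UNIV (\<lambda>u. \<beta> * E u)" by (intro continuous_intros E_cont)
      show "has_rs_integral E g a t (J a)" using J[OF a] by (simp add: E_def[abs_def])
    qed (use \<beta> g in \<open>auto simp: E_def\<close>)
    also have "integral {a..t} (\<lambda>u. \<beta> * E u * g u) =
        integral {a..t} (\<lambda>u. \<beta> * E u * g t) - integral {a..t} (\<lambda>u. \<beta> * E u * q u)"
      by (subst integral_diff[symmetric])
        (auto intro!: integrable_continuous_real continuous_intros cont E_cont simp: q_def algebra_simps)
    also have "integral {a..t} (\<lambda>u. \<beta> * E u * g t) = (E t - E a) * g t"
    proof -
      have "((\<lambda>u. \<beta> * E u) has_integral (E t - E a)) {a..t}"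
        using a E' by (intro fundamental_theorem_of_calculus)
          (auto simp: has_real_derivative_iff_has_vector_derivative intro: has_vector_derivative_at_within)
      from integral_unique[OF this] show ?thesis by simp
    qed
    also have "integral {a..t} (\<lambda>u. \<beta> * E u * q u) = (LINT u:{a..t}|lborel. \<beta> * E u * q u)"
      by (intro set_borel_integral_eq_integral(2)[symmetric] set_integrable_subset[OF qi]) auto
    finally show ?thesis by (simp add: q_def algebra_simps)
  qed
  have "((\<lambda>a. LINT u:{a..t}|lborel. \<beta> * E u * q u) \<longlongrightarrow> (LINT u:{..t}|lborel. \<beta> * E u * q u)) at_bot"
    using qi by (intro tendsto_set_lebesgue_integral_at_bot) auto
  then have "((\<lambda>a. J a - (LINT u:{a..t}|lborel. \<beta> * E u * q u)) \<longlongrightarrow> I - (LINT u:{..t}|lborel. \<beta> * E u * q u)) at_bot"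
    by (intro tendsto_intros JI)
  moreover have "\<forall>\<^sub>F a in at_bot. J a - (LINT u:{a..t}|lborel. \<beta> * E u * q u) = E a * q a"
    using eventually_gt_at_bot[of t] by eventually_elim (simp add: J_eq)
  ultimately have lim: "((\<lambda>a. E a * q a) \<longlongrightarrow> I - (LINT u:{..t}|lborel. \<beta> * E u * q u)) at_bot"
    by (rule Lim_transform_eventually)
  define l where "l = I - (LINT u:{..t}|lborel. \<beta> * E u * q u)"
  \<comment> \<open>The boundary term has a limit at minus infinity and is integrable there, so the limit is 0.\<close>
  have "l = 0"
  proof (rule ccontr)
    assume l: "l \<noteq> 0"
    have "((\<lambda>a. \<bar>E a * q a\<bar>) \<longlongrightarrow> \<bar>l\<bar>) at_bot"
      using lim unfolding l_def by (rule tendsto_rabs)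
    then have "\<forall>\<^sub>F a in at_bot. \<bar>E a * q a\<bar> > \<bar>l\<bar> / 2"
      using l by (intro order_tendstoD(1)) auto
    then obtain a0 where a0: "\<And>a. a \<le> a0 \<Longrightarrow> \<bar>E a * q a\<bar> > \<bar>l\<bar> / 2"
      by (auto simp: eventually_at_bot_linorder)
    define a1 where "a1 = min a0 t"
    define c where "c = \<beta> * \<bar>l\<bar> / 2"
    have c: "c > 0" using \<beta> l by (simp add: c_def)
    have bound: "c \<le> \<bar>\<beta> * E u * q u\<bar>" if "u \<le> a1" for u
      using a0[of u] that \<beta> by (simp add: c_def a1_def abs_mult mult.assoc)
    have "set_integrable lborel {..a1} (\<lambda>u. \<beta> * E u * q u)"
      by (rule set_integrable_subset[OF qi]) (auto simp: a1_def)
    then have "integrable lborel (\<lambda>u. indicator {..a1} u * c)"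
      unfolding set_integrable_def
      by (rule Bochner_Integration.integrable_bound) (use c bound in \<open>auto simp: indicator_def\<close>)
    then have "integrable lborel (indicator {..a1} :: real \<Rightarrow> real)"
      using c by simp
    then have fin: "emeasure lborel {..a1} < \<infinity>"
      by (simp add: integrable_indicator_iff)
    obtain n :: nat where n: "emeasure lborel {..a1} < of_nat n"
      using fin ennreal_Ex_less_of_nat[of "emeasure lborel {..a1}"] by auto
    have "of_nat n = emeasure lborel {a1 - real n..a1}"
      by (simp add: ennreal_of_nat_eq_real_of_nat)
    also have "\<dots> \<le> emeasure lborel {..a1}"
      by (intro emeasure_mono) auto
    finally show False using n by simp
  qed
  then show ?thesis using qI by (simp add: l_def)
qed

text \<open>Rounding the time down to the grid of mesh 1/(n+1) gives a function built from countably
  many measurable pieces; by continuity it converges pointwise. Joint measurability is what Fubini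
  requires when lags are averaged.\<close>

lemma continuous_paths_measurable:
  fixes X :: "real \<Rightarrow> 'a \<Rightarrow> real"
  assumes [measurable]: "\<And>t. X t \<in> borel_measurable M"
    and cont: "\<And>\<omega>. continuous_on UNIV (\<lambda>t. X t \<omega>)"
  shows "(\<lambda>(t, \<omega>). X t \<omega>) \<in> borel_measurable (borel \<Otimes>\<^sub>M M)"
proof (rule borel_measurable_LIMSEQ_real)
  define f where "f n p = X (real_of_int \<lfloor>real (Suc n) * fst p\<rfloor> / real (Suc n)) (snd p)" for n and p :: "real \<times> 'a"
  show "f n \<in> borel_measurable (borel \<Otimes>\<^sub>M M)" for n
  proof -
    have "(\<lambda>p. (\<lambda>k p. X (real_of_int k / real (Suc n)) (snd p)) \<lfloor>real (Suc n) * fst p\<rfloor> p)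
        \<in> borel_measurable (borel \<Otimes>\<^sub>M M)"
      by (rule measurable_compose_countable) measurable
    then show ?thesis by (simp add: f_def[abs_def])
  qed
  show "(\<lambda>n. f n p) \<longlonglongrightarrow> (\<lambda>(t, \<omega>). X t \<omega>) p" if "p \<in> space (borel \<Otimes>\<^sub>M M)" for p
  proof -
    obtain t \<omega> where p: "p = (t, \<omega>)" by fastforce
    have "(\<lambda>n. real_of_int \<lfloor>real (Suc n) * t\<rfloor> / real (Suc n)) \<longlonglongrightarrow> t"
    proof (rule tendsto_sandwich)
      show "\<forall>\<^sub>F n in sequentially. t - 1 / real (Suc n) \<le> real_of_int \<lfloor>real (Suc n) * t\<rfloor> / real (Suc n)"
      proof (intro always_eventually allI)
        fix n
        have "real (Suc n) * t - 1 \<le> real_of_int \<lfloor>real (Suc n) * t\<rfloor>" by linarith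
        then have "(real (Suc n) * t - 1) / real (Suc n) \<le> real_of_int \<lfloor>real (Suc n) * t\<rfloor> / real (Suc n)"
          by (rule divide_right_mono) simp
        then show "t - 1 / real (Suc n) \<le> real_of_int \<lfloor>real (Suc n) * t\<rfloor> / real (Suc n)"
          by (simp add: diff_divide_distrib)
      qed
      show "\<forall>\<^sub>F n in sequentially. real_of_int \<lfloor>real (Suc n) * t\<rfloor> / real (Suc n) \<le> t"
      proof (intro always_eventually allI)
        fix n
        have "real_of_int \<lfloor>real (Suc n) * t\<rfloor> \<le> real (Suc n) * t" by linarith
        then have "real_of_int \<lfloor>real (Suc n) * t\<rfloor> / real (Suc n) \<le> real (Suc n) * t / real (Suc n)"
          by (rule divide_right_mono) simp
        then show "real_of_int \<lfloor>real (Suc n) * t\<rfloor> / real (Suc n) \<le> t" by simp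
      qed
      have "(\<lambda>n. t - 1 / real (Suc n)) \<longlonglongrightarrow> t - 0"
        using lim_1_over_n[THEN LIMSEQ_Suc] by (intro tendsto_intros) simp
      then show "(\<lambda>n. t - 1 / real (Suc n)) \<longlonglongrightarrow> t" by simp
    qed simp
    with cont[of \<omega>] have "(\<lambda>n. X (real_of_int \<lfloor>real (Suc n) * t\<rfloor> / real (Suc n)) \<omega>) \<longlonglongrightarrow> X t \<omega>"
      by (intro isCont_tendsto_compose[where g = "\<lambda>t. X t \<omega>"]) (simp add: continuous_on_eq_continuous_at)
    then show ?thesis
      unfolding p f_def by simp
  qed
qed

section \<open>Second differences of the covariance kernel\<close>

definition cov_kernel :: "real \<Rightarrow> real \<Rightarrow> real \<Rightarrow> real \<Rightarrow> real" where
  "cov_kernel \<rho> \<eta> H x = (\<rho> - sign_rc x * \<eta>) * \<bar>x\<bar> powr H / 2"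

text \<open>The jump of the sign at 0 is annihilated by |x|^H; splitting into powers of the positive
  and negative parts makes this visible.\<close>

lemma continuous_cov_kernel:
  assumes "H > 0" shows "continuous_on UNIV (cov_kernel \<rho> \<eta> H)"
proof -
  have "cov_kernel \<rho> \<eta> H x = (\<rho> - \<eta>) / 2 * max x 0 powr H + (\<rho> + \<eta>) / 2 * max (- x) 0 powr H" for x
    by (auto simp: cov_kernel_def sign_rc_def max_def field_simps)
  moreover have "continuous_on UNIV (\<lambda>x :: real. (\<rho> - \<eta>) / 2 * max x 0 powr H + (\<rho> + \<eta>) / 2 * max (- x) 0 powr H)"
    using assms by (intro continuous_intros continuous_on_powr') auto
  ultimately show ?thesis by simp
qed

lemma abs_pinc_le:
  assumes "r < 1" "u > 0" "w \<ge> 0" shows "\<bar>pinc r w u\<bar> \<le> \<bar>r\<bar> * w * u powr (r - 1)"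
proof (cases "r = 0 \<or> w = 0")
  case True
  then show ?thesis using assms by (auto simp: pinc_def)
next
  case False
  then have "\<bar>pinc r w u\<bar> = \<bar>r\<bar> * (pinc r w u / r)"
    using pinc_quotient_bounds(1)[of r u w] assms by (auto simp: zero_less_divide_iff abs_if)
  also have "\<dots> \<le> \<bar>r\<bar> * (w * u powr (r - 1))"
    using pinc_quotient_bounds(2)[of r u w] assms False by (intro mult_left_mono) auto
  finally show ?thesis by (simp add: mult.assoc)
qed

text \<open>For the kernel g this is the covariance of the increment over [t - v, t] of one
  component with that over [s - w, s] of the other, where d = s - t.\<close>

definition second_diff :: "(real \<Rightarrow> real) \<Rightarrow> real \<Rightarrow> real \<Rightarrow> real \<Rightarrow> real" where
  "second_diff g d v w = g (d + v) + g (d - w) - g d - g (d + v - w)"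

text \<open>For d > w all four arguments are positive and the kernel is a multiple of x^H. Two mean
  value estimates, one for each increment, bound the second difference by a constant times (d -
  w)^(H-2).\<close>

lemma second_diff_cov_kernel_tendsto_0:
  assumes H: "0 < H" "H < 2" and v: "v \<ge> 0" and w: "w > 0"
  shows "((\<lambda>d. second_diff (cov_kernel \<rho> \<eta> H) d v w) \<longlongrightarrow> 0) at_top"
proof (rule Lim_null_comparison)
  define c where "c = (\<rho> - \<eta>) / 2"
  define C where "C = \<bar>c\<bar> * (w * (H * (\<bar>H - 1\<bar> * v)))"
  have "((\<lambda>d. C * (d - w) powr (H - 2)) \<longlongrightarrow> C * 0) at_top"
    using H by (intro tendsto_mult tendsto_const tendsto_neg_powr)
      (auto intro: filterlim_tendsto_add_at_top[OF tendsto_const filterlim_ident, of "- w", simplified])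
  then show "((\<lambda>d. C * (d - w) powr (H - 2)) \<longlongrightarrow> 0) at_top" by simp
  show "\<forall>\<^sub>F d in at_top. norm (second_diff (cov_kernel \<rho> \<eta> H) d v w) \<le> C * (d - w) powr (H - 2)"
    using eventually_gt_at_top[of w]
  proof eventually_elim
    case (elim d)
    have "\<exists>z. d - w < z \<and> z < d \<and> pinc H v d - pinc H v (d - w) = (d - (d - w)) * (H * pinc (H - 1) v z)"
      using elim v w by (intro MVT2 DERIV_pinc_u) auto
    then obtain z where z: "d - w < z" "z < d" "pinc H v d - pinc H v (d - w) = w * (H * pinc (H - 1) v z)"
      by auto
    have "second_diff (cov_kernel \<rho> \<eta> H) d v w = c * (pinc H v d - pinc H v (d - w))"
      using elim v w by (simp add: second_diff_def cov_kernel_def sign_rc_def pinc_def c_def field_simps)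
    also have "norm \<dots> = \<bar>c\<bar> * (w * (H * \<bar>pinc (H - 1) v z\<bar>))"
      using z w H by (simp add: abs_mult)
    also have "\<dots> \<le> \<bar>c\<bar> * (w * (H * (\<bar>H - 1\<bar> * v * (d - w) powr (H - 2))))"
    proof -
      have "\<bar>pinc (H - 1) v z\<bar> \<le> \<bar>H - 1\<bar> * v * z powr (H - 1 - 1)"
        using z elim H v by (intro abs_pinc_le) auto
      also have "\<dots> \<le> \<bar>H - 1\<bar> * v * (d - w) powr (H - 2)"
        using z elim H v by (intro mult_left_mono) (auto intro!: powr_mono2')
      finally show ?thesis using w H by (intro mult_left_mono) auto
    qed
    finally show ?case by (simp add: C_def mult_ac)
  qed
qed

section \<open>The stationary Ornstein--Uhlenbeck averages\<close>

lemma cov_kernel_measurable[measurable]: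
  assumes "H > 0" shows "cov_kernel \<rho> \<eta> H \<in> borel_measurable borel"
  using continuous_cov_kernel[OF assms] by (rule borel_measurable_continuous_onI)

lemma abs_cov_kernel_le:
  assumes "0 < H" "H < 2"
  shows "\<bar>cov_kernel \<rho> \<eta> H x\<bar> \<le> (\<bar>\<rho>\<bar> + \<bar>\<eta>\<bar>) * (1 + \<bar>x\<bar>)\<^sup>2"
proof -
  have "\<bar>\<rho> - sign_rc x * \<eta>\<bar> \<le> \<bar>\<rho>\<bar> + \<bar>\<eta>\<bar>"
    by (simp add: sign_rc_def abs_if)
  moreover have "\<bar>x\<bar> powr H \<le> (1 + \<bar>x\<bar>)\<^sup>2"
    using assms by (intro powr_le_power) auto
  ultimately have "\<bar>\<rho> - sign_rc x * \<eta>\<bar> * \<bar>x\<bar> powr H \<le> (\<bar>\<rho>\<bar> + \<bar>\<eta>\<bar>) * (1 + \<bar>x\<bar>)\<^sup>2"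
    by (intro mult_mono) auto
  moreover have "0 \<le> (\<bar>\<rho>\<bar> + \<bar>\<eta>\<bar>) * (1 + \<bar>x\<bar>)\<^sup>2"
    by simp
  moreover have "\<bar>cov_kernel \<rho> \<eta> H x\<bar> = \<bar>\<rho> - sign_rc x * \<eta>\<bar> * \<bar>x\<bar> powr H / 2"
    by (simp add: cov_kernel_def abs_mult)
  ultimately show ?thesis by linarith
qed

text \<open>Gaussianity is recorded only as the fourth moment identity on finite linear
  combinations, and paths are continuous for every \<omega>. The values \<rho> = 1 and \<eta> = 0 on
  the diagonal make one covariance formula serve both for each component and across
  components.\<close>

locale fou_moments = prob_space M for M :: "'a measure" +
  fixes X :: "'i \<Rightarrow> real \<Rightarrow> 'a \<Rightarrow> real" and h \<alpha> :: "'i \<Rightarrow> real" and \<rho> \<eta> :: "'i \<Rightarrow> 'i \<Rightarrow> real"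
  assumes X_measurable[measurable]: "X i t \<in> borel_measurable M"
    and X_cont: "continuous_on UNIV (\<lambda>t. X i t \<omega>)"
    and h: "0 < h i" "h i < 1" and \<alpha>: "\<alpha> i > 0"
    and lin_fourth: "finite J \<Longrightarrow> integrable M (\<lambda>\<omega>. (\<Sum>p\<in>J. c p * X (fst p) (snd p) \<omega>) ^ 4) \<and>
      expectation (\<lambda>\<omega>. (\<Sum>p\<in>J. c p * X (fst p) (snd p) \<omega>) ^ 4) =
        3 * (expectation (\<lambda>\<omega>. (\<Sum>p\<in>J. c p * X (fst p) (snd p) \<omega>)\<^sup>2))\<^sup>2"
    and cov: "expectation (\<lambda>\<omega>. X i t \<omega> * X j s \<omega>) =
      ((\<rho> i j + sign_rc t * \<eta> i j) * \<bar>t\<bar> powr (h i + h j) + (\<rho> i j - sign_rc s * \<eta> i j) * \<bar>s\<bar> powr (h i + h j)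
       - (\<rho> i j - sign_rc (s - t) * \<eta> i j) * \<bar>s - t\<bar> powr (h i + h j)) / 2"
    and diag: "\<rho> i i = 1" "\<eta> i i = 0"
begin

definition lin :: "('a \<Rightarrow> real) \<Rightarrow> bool" where
  "lin f \<longleftrightarrow> (\<exists>J c. finite J \<and> f = (\<lambda>\<omega>. \<Sum>p\<in>J. c p * X (fst p) (snd p) \<omega>))"

lemma lin_X: "lin (X i t)"
  unfolding lin_def by (rule exI[of _ "{(i, t)}"], rule exI[of _ "\<lambda>_. 1"]) auto

lemma lin_cmult:
  assumes "lin f" shows "lin (\<lambda>\<omega>. a * f \<omega>)"
proof -
  obtain J c where J: "finite J" "f = (\<lambda>\<omega>. \<Sum>p\<in>J. c p * X (fst p) (snd p) \<omega>)"
    using assms unfolding lin_def by blast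
  then have "(\<lambda>\<omega>. a * f \<omega>) = (\<lambda>\<omega>. \<Sum>p\<in>J. (a * c p) * X (fst p) (snd p) \<omega>)"
    by (simp add: sum_distrib_left mult.assoc)
  then show ?thesis
    unfolding lin_def using J(1) by (intro exI[of _ J] exI[of _ "\<lambda>p. a * c p"] conjI)
qed

lemma lin_add:
  assumes "lin f" "lin g" shows "lin (\<lambda>\<omega>. f \<omega> + g \<omega>)"
proof -
  obtain J c K d where J: "finite J" "f = (\<lambda>\<omega>. \<Sum>p\<in>J. c p * X (fst p) (snd p) \<omega>)"
    and K: "finite K" "g = (\<lambda>\<omega>. \<Sum>p\<in>K. d p * X (fst p) (snd p) \<omega>)"
    using assms unfolding lin_def by blast
  let ?e = "\<lambda>p. (if p \<in> J then c p else 0) + (if p \<in> K then d p else 0)"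
  have "f \<omega> + g \<omega> = (\<Sum>p\<in>J \<union> K. ?e p * X (fst p) (snd p) \<omega>)" for \<omega>
  proof -
    have "f \<omega> = (\<Sum>p\<in>J \<union> K. (if p \<in> J then c p else 0) * X (fst p) (snd p) \<omega>)"
      unfolding J(2) using J(1) K(1) by (intro sum.mono_neutral_cong_left) auto
    moreover have "g \<omega> = (\<Sum>p\<in>J \<union> K. (if p \<in> K then d p else 0) * X (fst p) (snd p) \<omega>)"
      unfolding K(2) using J(1) K(1) by (intro sum.mono_neutral_cong_left) auto
    ultimately show ?thesis by (simp add: sum.distrib[symmetric] distrib_right)
  qed
  then show ?thesis
    unfolding lin_def using J(1) K(1) by (intro exI[of _ "J \<union> K"] exI[of _ ?e]) auto
qed

lemma lin_diff: "lin f \<Longrightarrow> lin g \<Longrightarrow> lin (\<lambda>\<omega>. f \<omega> - g \<omega>)"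
  using lin_add[OF _ lin_cmult[where a = "-1"], of f g] by simp

lemma lin_moments:
  assumes "lin f"
  shows "L4 M f" "expectation (\<lambda>\<omega>. f \<omega> ^ 4) = 3 * (expectation (\<lambda>\<omega>. (f \<omega>)\<^sup>2))\<^sup>2"
  using assms lin_fourth unfolding lin_def L4_def by auto

lemma lin_wick:
  assumes "lin f1" "lin f2" "lin f3" "lin f4" shows "wick M f1 f2 f3 f4"
  by (intro wick_of_fourth_moments lin_moments lin_add lin_cmult assms)

section \<open>Backward increments, their exponential averages and the stationary covariance\<close>

definition D :: "'i \<Rightarrow> real \<Rightarrow> real \<Rightarrow> 'a \<Rightarrow> real" where
  "D i t v \<omega> = X i t \<omega> - X i (t - v) \<omega>"

definition Z :: "'i \<Rightarrow> real \<Rightarrow> 'a \<Rightarrow> real" where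
  "Z i t \<omega> = (\<integral>v. D i t v \<omega> \<partial>exp_law (\<alpha> i))"

definition \<gamma> :: "'i \<Rightarrow> 'i \<Rightarrow> real \<Rightarrow> real" where
  "\<gamma> i j = cov_kernel (\<rho> i j) (\<eta> i j) (h i + h j)"

lemma lin_D: "lin (D i t v)"
  unfolding D_def[abs_def] by (intro lin_diff lin_X)

lemmas L4_D = lin_moments(1)[OF lin_D]

lemma prob_space_exp_law: "prob_space (exp_law (\<alpha> i))"
  using \<alpha> by (rule prob_space_exponential_density)

text \<open>Of the three powers in each covariance, those in the two separate times cancel over the
  four terms; only values of \<gamma> at time differences survive, which is the
  stationarity.\<close>

lemma expectation_D_D:
  "expectation (\<lambda>\<omega>. D i t v \<omega> * D j s w \<omega>) = second_diff (\<gamma> i j) (s - t) v w"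
proof -
  have [simp]: "integrable M (\<lambda>\<omega>. X i t \<omega> * X j s \<omega>)" for i j t s
    by (intro L4_integrable_mult lin_moments lin_X)
  have "expectation (\<lambda>\<omega>. D i t v \<omega> * D j s w \<omega>)
      = expectation (\<lambda>\<omega>. X i t \<omega> * X j s \<omega> - X i t \<omega> * X j (s - w) \<omega>
          - X i (t - v) \<omega> * X j s \<omega> + X i (t - v) \<omega> * X j (s - w) \<omega>)"
    by (simp add: D_def algebra_simps)
  also have "\<dots> = expectation (\<lambda>\<omega>. X i t \<omega> * X j s \<omega>) - expectation (\<lambda>\<omega>. X i t \<omega> * X j (s - w) \<omega>)
          - expectation (\<lambda>\<omega>. X i (t - v) \<omega> * X j s \<omega>) + expectation (\<lambda>\<omega>. X i (t - v) \<omega> * X j (s - w) \<omega>)"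
    by simp
  also have "\<dots> = \<gamma> i j (s - t + v) + \<gamma> i j (s - t - w) - \<gamma> i j (s - t) - \<gamma> i j (s - t + v - w)"
  proof -
    have *: "expectation (\<lambda>\<omega>. X i t \<omega> * X j s \<omega>) =
      (\<rho> i j + sign_rc t * \<eta> i j) * \<bar>t\<bar> powr (h i + h j) / 2 + (\<rho> i j - sign_rc s * \<eta> i j) * \<bar>s\<bar> powr (h i + h j) / 2
       - \<gamma> i j (s - t)" for t s
      unfolding cov \<gamma>_def cov_kernel_def by (simp add: add_divide_distrib diff_divide_distrib)
    have e: "s - w - t = s - t - w" "s - (t - v) = s - t + v" "s - w - (t - v) = s - t + v - w"
      by simp_all
    show ?thesis unfolding * e by simp
  qed
  finally show ?thesis by (simp add: second_diff_def)
qed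

lemma expectation_D_power2: "expectation (\<lambda>\<omega>. (D i t v \<omega>)\<^sup>2) = \<bar>v\<bar> powr (2 * h i)"
  using expectation_D_D[of i t v i t v]
  by (simp add: power2_eq_square second_diff_def \<gamma>_def cov_kernel_def diag)

lemma expectation_D_power2_le:
  assumes "v \<ge> 0" shows "expectation (\<lambda>\<omega>. (D i t v \<omega>)\<^sup>2) \<le> (1 + v)\<^sup>2"
  unfolding expectation_D_power2 using h[of i] assms powr_le_power[of v "2 * h i" 2] by simp

lemma D_measurable[measurable]: "case_prod (D i t) \<in> borel_measurable (exp_law (\<alpha> i) \<Otimes>\<^sub>M M)"
proof -
  have [measurable]: "(\<lambda>(t, \<omega>). X i t \<omega>) \<in> borel_measurable (borel \<Otimes>\<^sub>M M)"
    by (intro continuous_paths_measurable X_measurable X_cont)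
  have "(\<lambda>p. X i t (snd p) - (\<lambda>(t, \<omega>). X i t \<omega>) (t - fst p, snd p)) \<in> borel_measurable (borel \<Otimes>\<^sub>M M)"
    by measurable
  moreover have "sets (exp_law (\<alpha> i) \<Otimes>\<^sub>M M) = sets (borel \<Otimes>\<^sub>M M)"
    by (intro sets_pair_measure_cong) auto
  ultimately show ?thesis
    by (simp add: D_def case_prod_unfold cong: measurable_cong_sets)
qed

lemma averaging_D: "averaging M (exp_law (\<alpha> i)) (D i t)"
proof -
  interpret Q: prob_space "exp_law (\<alpha> i)" by (rule prob_space_exp_law)
  interpret PQ: pair_prob_space "exp_law (\<alpha> i)" M ..
  show ?thesis
  proof (intro averaging.intro averaging_axioms.intro)
    show "prob_space M" by (rule prob_space_axioms)
    show "prob_space (exp_law (\<alpha> i))" by (rule prob_space_exp_law)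
    show "integrable (exp_law (\<alpha> i) \<Otimes>\<^sub>M M) (\<lambda>(v, \<omega>). D i t v \<omega> ^ 4)"
    proof (rule PQ.Fubini_integrable)
      have "integrable (exp_law (\<alpha> i)) (\<lambda>v. expectation (\<lambda>\<omega>. D i t v \<omega> ^ 4))"
      \<comment> \<open>The fourth moment of an increment is 3 times its squared variance, and the
        variance is at most (1 + v)^2.\<close>
      proof (rule exp_law_integrable_bound[OF \<alpha>, where C = 3 and a = 1 and n = 4])
        show "(\<lambda>v. expectation (\<lambda>\<omega>. D i t v \<omega> ^ 4)) \<in> borel_measurable borel"
        proof -
          have "(\<lambda>v. expectation (\<lambda>\<omega>. D i t v \<omega> ^ 4)) \<in> borel_measurable (exp_law (\<alpha> i))"
            by measurable
          then show ?thesis by simp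
        qed
        show "\<bar>expectation (\<lambda>\<omega>. D i t v \<omega> ^ 4)\<bar> \<le> 3 * (1 + v) ^ 4" if "v \<ge> 0" for v
          using power_mono[OF expectation_D_power2_le[OF that, of i t], of 2]
          by (simp add: lin_moments[OF lin_D])
      qed
      then show "integrable (exp_law (\<alpha> i)) (\<lambda>v. expectation (\<lambda>\<omega>. norm (case (v, \<omega>) of (v, \<omega>) \<Rightarrow> D i t v \<omega> ^ 4)))"
        by simp
      show "AE v in exp_law (\<alpha> i). integrable M (\<lambda>\<omega>. case (v, \<omega>) of (v, \<omega>) \<Rightarrow> D i t v \<omega> ^ 4)"
        using L4_D by (simp add: L4_def)
    qed measurable
  qed (rule D_measurable)
qed

lemma avg_D: "averaging.avg (exp_law (\<alpha> i)) (D i t) = Z i t"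
  by (simp add: fun_eq_iff averaging.avg_def[OF averaging_D] Z_def)

lemma L4_Z: "L4 M (Z i t)"
  using averaging.L4_avg[OF averaging_D, of i t] by (simp add: avg_D)

lemma Z_measurable[measurable]: "Z i t \<in> borel_measurable M"
  using L4_Z by (rule L4_measurable)

lemma expectation_Z_mult:
  assumes "L4 M f"
  shows "expectation (\<lambda>\<omega>. Z i t \<omega> * f \<omega>) = (\<integral>v. expectation (\<lambda>\<omega>. D i t v \<omega> * f \<omega>) \<partial>exp_law (\<alpha> i))"
    and "integrable (exp_law (\<alpha> i)) (\<lambda>v. expectation (\<lambda>\<omega>. D i t v \<omega> * f \<omega>))"
  using averaging.integral_avg_mult[OF averaging_D assms, of i t] by (simp_all add: avg_D)

text \<open>One argument is averaged per round, for all values of the lags still present, and a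
  rotation brings the next increment to the front. After four rounds a last rotation restores the
  order.\<close>

lemma Z_wick: "wick M (Z i1 t1) (Z i2 t2) (Z i3 t3) (Z i4 t4)"
proof -
  note avg = averaging.wick_avg[OF averaging_D, unfolded avg_D]
  have 1: "wick M (Z i1 t1) (D i2 t2 v) (D i3 t3 w) (D i4 t4 x)" for v w x
    by (intro avg L4_D lin_wick lin_D)
  have 2: "wick M (Z i2 t2) (D i3 t3 w) (D i4 t4 x) (Z i1 t1)" for w x
    by (intro avg L4_D L4_Z wick_rotate[OF 1])
  have 3: "wick M (Z i3 t3) (D i4 t4 x) (Z i1 t1) (Z i2 t2)" for x
    by (intro avg L4_D L4_Z wick_rotate[OF 2])
  have "wick M (Z i4 t4) (Z i1 t1) (Z i2 t2) (Z i3 t3)"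
    by (intro avg L4_D L4_Z wick_rotate[OF 3])
  then show ?thesis by (rule wick_rotate)
qed

definition C :: "'i \<Rightarrow> 'i \<Rightarrow> real \<Rightarrow> real" where
  "C i j d = (\<integral>v. (\<integral>w. second_diff (\<gamma> i j) d v w \<partial>exp_law (\<alpha> j)) \<partial>exp_law (\<alpha> i))"

lemma expectation_D_Z:
  "expectation (\<lambda>\<omega>. D i t v \<omega> * Z j s \<omega>) = (\<integral>w. second_diff (\<gamma> i j) (s - t) v w \<partial>exp_law (\<alpha> j))"
  using expectation_Z_mult(1)[OF L4_D, of j s i t v] by (simp add: mult.commute expectation_D_D)

lemma expectation_Z_Z: "expectation (\<lambda>\<omega>. Z i t \<omega> * Z j s \<omega>) = C i j (s - t)"
  by (simp add: expectation_Z_mult(1)[OF L4_Z] expectation_D_Z C_def)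

text \<open>Reading the second difference as a covariance and bounding it by two variances gives a
  majorant uniform in d, although the single values of the kernel may grow with d. This is the
  domination needed as d tends to infinity.\<close>

lemma second_diff_bound:
  assumes "v \<ge> 0" "w \<ge> 0"
  shows "\<bar>second_diff (\<gamma> i j) d v w\<bar> \<le> (1 + v)\<^sup>2 + (1 + w)\<^sup>2"
proof -
  have i: "integrable M (\<lambda>\<omega>. (D i t v \<omega>)\<^sup>2)" for i t v
    by (intro L4_integrable_power2 L4_D)
  have "\<bar>expectation (\<lambda>\<omega>. D i 0 v \<omega> * D j d w \<omega>)\<bar> \<le> expectation (\<lambda>\<omega>. \<bar>D i 0 v \<omega> * D j d w \<omega>\<bar>)"
    by (rule integral_abs_bound)
  also have "\<dots> \<le> expectation (\<lambda>\<omega>. (D i 0 v \<omega>)\<^sup>2 + (D j d w \<omega>)\<^sup>2)"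
  proof (rule Bochner_Integration.integral_mono)
    show "\<bar>D i 0 v \<omega> * D j d w \<omega>\<bar> \<le> (D i 0 v \<omega>)\<^sup>2 + (D j d w \<omega>)\<^sup>2" for \<omega>
      using sum_squares_bound[of "\<bar>D i 0 v \<omega>\<bar>" "\<bar>D j d w \<omega>\<bar>"] abs_ge_zero[of "D i 0 v \<omega> * D j d w \<omega>"]
      unfolding abs_mult power2_abs by linarith
  qed (use i L4_integrable_mult[OF L4_D L4_D] in auto)
  also have "\<dots> \<le> (1 + v)\<^sup>2 + (1 + w)\<^sup>2"
    using i assms by (simp add: add_mono expectation_D_power2_le)
  finally show ?thesis by (simp add: expectation_D_D)
qed

lemma \<gamma>_measurable[measurable]: "\<gamma> i j \<in> borel_measurable borel"
  unfolding \<gamma>_def using h[of i] h[of j] by (intro cov_kernel_measurable) auto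

lemma second_diff_measurable[measurable]:
  "(\<lambda>(v, w). second_diff (\<gamma> i j) d v w) \<in> borel_measurable (exp_law a \<Otimes>\<^sub>M exp_law b)"
  "second_diff (\<gamma> i j) d v \<in> borel_measurable (exp_law b)"
  unfolding second_diff_def[abs_def] by measurable

lemma C_tendsto_0: "((\<lambda>d. C i j d) \<longlongrightarrow> 0) at_top"
proof -
  interpret A: prob_space "exp_law (\<alpha> i)" by (rule prob_space_exp_law)
  interpret B: prob_space "exp_law (\<alpha> j)" by (rule prob_space_exp_law)
  have poly: "integrable (exp_law (\<alpha> i)) (\<lambda>v. (1 + v)\<^sup>2)" for i
    by (rule exp_law_integrable_bound[OF \<alpha>, where C = 1 and a = 1 and n = 2]) auto
  have inner: "((\<lambda>d. \<integral>w. second_diff (\<gamma> i j) d v w \<partial>exp_law (\<alpha> j)) \<longlongrightarrow> (\<integral>w. 0 \<partial>exp_law (\<alpha> j))) at_top"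
    if v: "v > 0" for v
  proof (rule integral_dominated_convergence_at_top)
    show "integrable (exp_law (\<alpha> j)) (\<lambda>w. (1 + v)\<^sup>2 + (1 + w)\<^sup>2)"
      using poly by simp
    show "AE w in exp_law (\<alpha> j). ((\<lambda>d. second_diff (\<gamma> i j) d v w) \<longlongrightarrow> 0) at_top"
      using AE_exp_law_pos[OF \<alpha>]
      by eventually_elim (use h[of i] h[of j] v in \<open>auto simp: \<gamma>_def intro!: second_diff_cov_kernel_tendsto_0\<close>)
    show "\<forall>\<^sub>F d in at_top. AE w in exp_law (\<alpha> j). norm (second_diff (\<gamma> i j) d v w) \<le> (1 + v)\<^sup>2 + (1 + w)\<^sup>2"
    proof (rule always_eventually, rule allI)
      fix d show "AE w in exp_law (\<alpha> j). norm (second_diff (\<gamma> i j) d v w) \<le> (1 + v)\<^sup>2 + (1 + w)\<^sup>2"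
        using AE_exp_law_pos[OF \<alpha>] by eventually_elim (use v in \<open>simp add: second_diff_bound\<close>)
    qed
  qed simp_all
  have "((\<lambda>d. C i j d) \<longlongrightarrow> (\<integral>v. 0 \<partial>exp_law (\<alpha> i))) at_top"
    unfolding C_def
  proof (rule integral_dominated_convergence_at_top)
    define c where "c = (\<integral>w. (1 + w)\<^sup>2 \<partial>exp_law (\<alpha> j))"
    show "integrable (exp_law (\<alpha> i)) (\<lambda>v. (1 + v)\<^sup>2 + c)"
      using poly by simp
    show "AE v in exp_law (\<alpha> i). ((\<lambda>d. \<integral>w. second_diff (\<gamma> i j) d v w \<partial>exp_law (\<alpha> j)) \<longlongrightarrow> 0) at_top"
      using AE_exp_law_pos[OF \<alpha>] by eventually_elim (use inner in simp)
    show "\<forall>\<^sub>F d in at_top. AE v in exp_law (\<alpha> i).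
        norm (\<integral>w. second_diff (\<gamma> i j) d v w \<partial>exp_law (\<alpha> j)) \<le> (1 + v)\<^sup>2 + c"
    proof (rule always_eventually, rule allI)
      fix d show "AE v in exp_law (\<alpha> i). norm (\<integral>w. second_diff (\<gamma> i j) d v w \<partial>exp_law (\<alpha> j)) \<le> (1 + v)\<^sup>2 + c"
        using AE_exp_law_pos[OF \<alpha>]
      proof eventually_elim
        case (elim v)
        have "norm (\<integral>w. second_diff (\<gamma> i j) d v w \<partial>exp_law (\<alpha> j)) \<le> (\<integral>w. norm (second_diff (\<gamma> i j) d v w) \<partial>exp_law (\<alpha> j))"
          by (rule integral_norm_bound)
        also have "\<dots> \<le> (\<integral>w. (1 + v)\<^sup>2 + (1 + w)\<^sup>2 \<partial>exp_law (\<alpha> j))"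
        proof (rule integral_mono_AE')
          show "AE w in exp_law (\<alpha> j). norm (second_diff (\<gamma> i j) d v w) \<le> (1 + v)\<^sup>2 + (1 + w)\<^sup>2"
            using AE_exp_law_pos[OF \<alpha>] by eventually_elim (use elim in \<open>simp add: second_diff_bound\<close>)
        qed (use poly in auto)
        also have "\<dots> = (1 + v)\<^sup>2 + c"
          using poly B.prob_space by (simp add: c_def)
        finally show ?case .
      qed
    qed
  qed simp_all
  then show ?thesis by simp
qed

lemma converges_L2_lagged:
  "converges_L2 M (\<lambda>n \<omega>. 1 / real n * (\<Sum>k=1..n - s. Z i (real (k + p)) \<omega> * Z j (real (k + q)) \<omega>))
     (\<lambda>_. C i j (real q - real p))"
proof (rule converges_L2_mean)
  show "prob_space M" by (rule prob_space_axioms)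
  \<comment> \<open>Of the three pairings in the Wick formula, the one within each product is the
    square of the mean and is subtracted. The two others pair equal components at lag m, and
    different components at lags m shifted by q - p and p - q.\<close>
  let ?r = "\<lambda>m. C i i (real m) * C j j (real m)
      + C i j (real m + (real q - real p)) * C j i (real m + (real p - real q))"
  have lim: "(\<lambda>m. C i j (real m + c)) \<longlonglongrightarrow> 0" for i j c
  proof (rule filterlim_compose[OF C_tendsto_0])
    have "filterlim (\<lambda>m. c + real m) at_top sequentially"
      by (rule filterlim_tendsto_add_at_top[OF tendsto_const filterlim_real_sequentially])
    then show "filterlim (\<lambda>m. real m + c) at_top sequentially" by (simp add: add.commute)
  qed
  show "?r \<longlonglongrightarrow> 0"
    using lim[of _ _ 0] lim by (auto intro!: tendsto_eq_intros)
  show "integrable M (\<lambda>\<omega>. (Z i (real (k + p)) \<omega> * Z j (real (k + q)) \<omega>)\<^sup>2)" for k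
    using L4_integrable_mult4[OF L4_Z L4_Z L4_Z L4_Z, of i "real (k + p)" i "real (k + p)" j "real (k + q)" j "real (k + q)"]
    by (simp add: power2_eq_square mult_ac)
  show "expectation (\<lambda>\<omega>. Z i (real (k + p)) \<omega> * Z j (real (k + q)) \<omega>) = C i j (real q - real p)" for k
    by (simp add: expectation_Z_Z)
  show "expectation (\<lambda>\<omega>. Z i (real (k + p)) \<omega> * Z j (real (k + q)) \<omega> *
      (Z i (real (l + p)) \<omega> * Z j (real (l + q)) \<omega>)) - (C i j (real q - real p))\<^sup>2 = ?r (l - k)" if "k \<le> l" for k l
    using Z_wick[of i "real (k + p)" j "real (k + q)" i "real (l + p)" j "real (l + q)"] that
    unfolding wick_def expectation_Z_Z
    by (simp add: mult.assoc power2_eq_square of_nat_diff algebra_simps)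
qed measurable

text \<open>The argument - s puts component i at the later time, so the exponential transform acts
  on its lag v with w fixed. On [0, s] the transformed function is a multiple of
  \<open>pinc H w\<close>, and averaging over w then yields I.\<close>

lemma lagged_covariance:
  assumes s: "s > 0" and H: "h i + h j \<noteq> 1"
  defines "H \<equiv> h i + h j"
  defines "I \<equiv> (LINT u:{0..s}|lborel. exp (\<alpha> i * u) * (LINT v:{..0}|lborel. exp (\<alpha> j * v) * (u - v) powr (H - 2)))"
  shows "exp (\<alpha> i * s) * C i j (- s) - C i j 0 = (\<rho> i j + \<eta> i j) / 2 * (H * (H - 1) * I)" and "I > 0"
proof -
  have H': "0 < H" "H < 2" "H \<noteq> 1" using h[of i] h[of j] H by (auto simp: H_def)
  define k where "k = (\<rho> i j + \<eta> i j) / 2"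
  \<comment> \<open>\<open>C\<close> integrates over v outside, but the transform needs the
    v-integral inside. The exchange comes from the symmetry of E(Z_i Z_j), expanding the factor Z_j
    first.\<close>
  have C_eq: "C i j (- t) = (\<integral>w. (\<integral>v. second_diff (\<gamma> i j) (- t) v w \<partial>exp_law (\<alpha> i)) \<partial>exp_law (\<alpha> j))"
    and C_int: "integrable (exp_law (\<alpha> j)) (\<lambda>w. \<integral>v. second_diff (\<gamma> i j) (- t) v w \<partial>exp_law (\<alpha> i))" for t
  proof -
    have *: "expectation (\<lambda>\<omega>. D j 0 w \<omega> * Z i t \<omega>) = (\<integral>v. second_diff (\<gamma> i j) (- t) v w \<partial>exp_law (\<alpha> i))" for w
      using expectation_Z_mult(1)[OF L4_D, of i t j 0 w] by (simp add: mult.commute expectation_D_D)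
    show "C i j (- t) = (\<integral>w. (\<integral>v. second_diff (\<gamma> i j) (- t) v w \<partial>exp_law (\<alpha> i)) \<partial>exp_law (\<alpha> j))"
      using expectation_Z_mult(1)[OF L4_Z, of j 0 i t] expectation_Z_Z[of i t j 0] by (simp add: * mult.commute)
    show "integrable (exp_law (\<alpha> j)) (\<lambda>w. \<integral>v. second_diff (\<gamma> i j) (- t) v w \<partial>exp_law (\<alpha> i))"
      using expectation_Z_mult(2)[OF L4_Z, of j 0 i t] by (simp add: *)
  qed
  have kernel: "exp (\<alpha> i * s) * (\<integral>v. second_diff (\<gamma> i j) (- s) v w \<partial>exp_law (\<alpha> i))
      - (\<integral>v. second_diff (\<gamma> i j) (- 0) v w \<partial>exp_law (\<alpha> i)) = k * kernel_int H (\<alpha> i) s w" if w: "w > 0" for w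
  proof -
    \<comment> \<open>With this F the second difference at - t is \<open>F t - F (t - v)\<close>, an
      increment in v of a function of one variable, as \<open>exp_law_increment_transform\<close>
      expects.\<close>
    define F where "F u = \<gamma> i j (- w - u) - \<gamma> i j (- u)" for u
    have \<gamma>_cont: "continuous_on UNIV (\<gamma> i j)"
      unfolding \<gamma>_def using h[of i] h[of j] by (intro continuous_cov_kernel) auto
    have F_cont: "continuous_on UNIV F"
      unfolding F_def
      by (intro continuous_on_diff continuous_on_compose2[OF \<gamma>_cont] continuous_on_minus
          continuous_on_const continuous_on_id subset_UNIV)
    have F_meas[measurable]: "F \<in> borel_measurable borel"
      using F_cont by (rule borel_measurable_continuous_onI)
    have F_int: "integrable (exp_law (\<alpha> i)) (\<lambda>v. F (t - v))" for t
    proof (rule exp_law_integrable_bound[OF \<alpha>])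
      fix v :: real assume v: "v \<ge> 0"
      let ?c = "\<bar>\<rho> i j\<bar> + \<bar>\<eta> i j\<bar>"
      have b: "\<bar>\<gamma> i j x\<bar> \<le> ?c * ((1 + \<bar>t\<bar> + w) + v)\<^sup>2" if "\<bar>x\<bar> \<le> \<bar>t\<bar> + w + v" for x
      proof -
        have "\<bar>\<gamma> i j x\<bar> \<le> ?c * (1 + \<bar>x\<bar>)\<^sup>2"
          unfolding \<gamma>_def using H' by (intro abs_cov_kernel_le) (auto simp: H_def)
        also have "\<dots> \<le> ?c * ((1 + \<bar>t\<bar> + w) + v)\<^sup>2"
          using that by (intro mult_left_mono power_mono) auto
        finally show ?thesis .
      qed
      have "\<bar>F (t - v)\<bar> \<le> \<bar>\<gamma> i j (- w - (t - v))\<bar> + \<bar>\<gamma> i j (- (t - v))\<bar>"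
        unfolding F_def by (rule abs_triangle_ineq4)
      also have "\<dots> \<le> ?c * ((1 + \<bar>t\<bar> + w) + v)\<^sup>2 + ?c * ((1 + \<bar>t\<bar> + w) + v)\<^sup>2"
        using v w by (intro add_mono b) auto
      finally show "\<bar>F (t - v)\<bar> \<le> (2 * ?c) * ((1 + \<bar>t\<bar> + w) + v)\<^sup>2"
        by (simp only: mult_2 distrib_right)
    qed simp
    have sd: "second_diff (\<gamma> i j) (- t) v w = F t - F (t - v)" for t v
    proof -
      have e: "- t + v = - (t - v)" "- t - w = - w - t" "- (t - v) - w = - w - (t - v)"
        by simp_all
      show ?thesis unfolding second_diff_def F_def e by simp
    qed
    \<comment> \<open>For u > 0 both kernel arguments are negative, where the sign is -1; this
      produces \<rho> + \<eta>. At u = 0 the sign convention gives +1 instead, but its coefficient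
      |0|^H is 0.\<close>
    have F_pos: "F u = k * pinc H w u" if "u \<ge> 0" for u
      using that w H' unfolding F_def \<gamma>_def cov_kernel_def pinc_def k_def sign_rc_def H_def[symmetric]
      by (cases "u = 0") (auto simp: field_simps)
    have "exp (\<alpha> i * s) * (\<integral>v. second_diff (\<gamma> i j) (- s) v w \<partial>exp_law (\<alpha> i))
      - (\<integral>v. second_diff (\<gamma> i j) (- 0) v w \<partial>exp_law (\<alpha> i))
      = exp (\<alpha> i * s) * F s - F 0 - \<alpha> i * (LINT u:{0..s}|lborel. exp (\<alpha> i * u) * F u)"
      unfolding sd using s by (intro exp_law_increment_transform F_cont \<alpha> F_int) auto
    also have "(LINT u:{0..s}|lborel. exp (\<alpha> i * u) * F u) = (LINT u:{0..s}|lborel. k * (exp (\<alpha> i * u) * pinc H w u))"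
      by (intro set_lebesgue_integral_cong) (auto simp: F_pos)
    also have "\<dots> = k * (LINT u:{0..s}|lborel. exp (\<alpha> i * u) * pinc H w u)"
      by (rule set_integral_mult_right)
    finally show ?thesis
      using s by (simp add: F_pos kernel_int_def algebra_simps)
  qed
  have "exp (\<alpha> i * s) * C i j (- s) - C i j (- 0)
      = (\<integral>w. exp (\<alpha> i * s) * (\<integral>v. second_diff (\<gamma> i j) (- s) v w \<partial>exp_law (\<alpha> i))
      - (\<integral>v. second_diff (\<gamma> i j) (- 0) v w \<partial>exp_law (\<alpha> i)) \<partial>exp_law (\<alpha> j))"
    unfolding C_eq using C_int[of s] C_int[of 0]
    by (subst Bochner_Integration.integral_diff) (auto simp del: minus_zero)
  also have "\<dots> = (\<integral>w. k * kernel_int H (\<alpha> i) s w \<partial>exp_law (\<alpha> j))"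
  proof (rule integral_cong_AE)
    show "AE w in exp_law (\<alpha> j). exp (\<alpha> i * s) * (\<integral>v. second_diff (\<gamma> i j) (- s) v w \<partial>exp_law (\<alpha> i))
      - (\<integral>v. second_diff (\<gamma> i j) (- 0) v w \<partial>exp_law (\<alpha> i)) = k * kernel_int H (\<alpha> i) s w"
      using AE_exp_law_pos[OF \<alpha>] by eventually_elim (rule kernel)
    show "(\<lambda>w. exp (\<alpha> i * s) * (\<integral>v. second_diff (\<gamma> i j) (- s) v w \<partial>exp_law (\<alpha> i))
      - (\<integral>v. second_diff (\<gamma> i j) (- 0) v w \<partial>exp_law (\<alpha> i))) \<in> borel_measurable (exp_law (\<alpha> j))"
      by (intro borel_measurable_diff borel_measurable_times borel_measurable_const
          borel_measurable_integrable C_int)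
  qed simp
  also have "\<dots> = k * (H * (H - 1) * I)"
    using kernel_int_integral(1)[OF H' \<alpha>[of i] \<alpha>[of j] s] by (simp add: I_def)
  finally show "exp (\<alpha> i * s) * C i j (- s) - C i j 0 = (\<rho> i j + \<eta> i j) / 2 * (H * (H - 1) * I)"
    by (simp add: k_def)
  show "I > 0"
    unfolding I_def by (rule kernel_int_integral(2)[OF H' \<alpha> \<alpha> s])
qed

end

section \<open>Identification with the Ornstein--Uhlenbeck process\<close>

lemma (in fou_moments) fou_eq_Z:
  assumes "AE \<omega> in M. has_rs_integral_atMost (\<lambda>u. exp (- \<alpha> i * (t - u))) (\<lambda>u. X i u \<omega>) t (I \<omega>)"
  shows "AE \<omega> in M. I \<omega> = Z i t \<omega>"
proof -
  have "AE \<omega> in M. integrable (exp_law (\<alpha> i)) (\<lambda>v. D i t v \<omega>)"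
    by (rule averaging.AE_integrable_U[OF averaging_D])
  with assms show ?thesis
  proof eventually_elim
    case (elim \<omega>)
    then show ?case
      unfolding Z_def D_def by (intro rs_integral_atMost_exp X_cont \<alpha>)
  qed
qed

text \<open>The set of discontinuous paths need not be measurable, so paths are set to 0 on a
  measurable null set containing it. Continuity for every \<omega> then allows joint measurability
  in time and \<omega>.\<close>

lemma continuous_version:
  fixes B :: "real \<Rightarrow> 'a \<Rightarrow> real"
  assumes [measurable]: "\<And>t. B t \<in> borel_measurable M"
    and "AE \<omega> in M. continuous_on UNIV (\<lambda>t. B t \<omega>)"
  obtains X where "\<And>t. X t \<in> borel_measurable M" "\<And>\<omega>. continuous_on UNIV (\<lambda>t. X t \<omega>)"
    "AE \<omega> in M. \<forall>t. X t \<omega> = B t \<omega>"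
proof -
  obtain N where N: "N \<in> null_sets M" "{\<omega> \<in> space M. \<not> continuous_on UNIV (\<lambda>t. B t \<omega>)} \<subseteq> N"
    using assms(2) unfolding eventually_ae_filter by blast
  have [measurable]: "N \<in> sets M" using N(1) by auto
  define X where "X t \<omega> = (if \<omega> \<in> space M - N then B t \<omega> else 0)" for t \<omega>
  show thesis
  proof
    show "X t \<in> borel_measurable M" for t
      unfolding X_def by measurable
    show "continuous_on UNIV (\<lambda>t. X t \<omega>)" for \<omega>
      using N(2) by (cases "\<omega> \<in> space M - N") (auto simp: X_def)
    show "AE \<omega> in M. \<forall>t. X t \<omega> = B t \<omega>"
      using AE_not_in[OF N(1)] AE_space by eventually_elim (simp add: X_def)
  qed
qed

text \<open>Indexing the two components by \<^typ>\<open>bool\<close> frees the locale \<^locale>\<open>fou_moments\<close> from side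
  conditions on indices.\<close>

definition component :: "bool \<Rightarrow> nat" where
  "component b = (if b then 1 else 2)"

lemma component_simps[simp]: "component True = 1" "component False = 2" "component b \<in> {1, 2}"
  "component b = component c \<longleftrightarrow> b = c"
  by (auto simp: component_def)

text \<open>A finite linear combination of X agrees almost surely with one of B over the relabelled
  index set, and the latter is Gaussian because the two components are jointly Gaussian.\<close>

lemma bivariate_fbm_fou_moments:
  fixes \<rho> :: real
  assumes "prob_space M"
    and h: "\<And>b. h (component b) \<in> {0<..<1}" and \<alpha>: "\<And>b. \<alpha> (component b) > 0"
    and B: "bivariate_fbm M h \<rho> \<eta> B"
    and X_meas: "\<And>b t. X b t \<in> borel_measurable M"
    and X_cont: "\<And>b \<omega>. continuous_on UNIV (\<lambda>t. X b t \<omega>)"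
    and X_B: "\<And>b. AE \<omega> in M. \<forall>t. X b t \<omega> = B (component b) t \<omega>"
  shows "fou_moments M X (\<lambda>b. h (component b)) (\<lambda>b. \<alpha> (component b))
    (\<lambda>b c. if b = c then 1 else \<rho>) (\<lambda>b c. if b = c then 0 else \<eta> (component b) (component c))"
proof -
  interpret prob_space M by fact
  have gauss: "centered_gaussian_process M ({1, 2} \<times> UNIV) (\<lambda>(i, t). B i t)"
    using B by (simp add: bivariate_fbm_def)
  have [measurable]: "X b t \<in> borel_measurable M" for b t by (rule X_meas)
  have B_meas[measurable]: "B (component b) t \<in> borel_measurable M" for b t
  proof -
    have "{(component b, t)} \<subseteq> {1, 2} \<times> UNIV" by (auto simp: component_def)
    then have "centered_gaussian M (B (component b) t)"
      using gauss[unfolded centered_gaussian_process_def, rule_format, of "{(component b, t)}" "\<lambda>_. 1"]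
      by simp
    then show ?thesis by (simp add: centered_gaussian_def)
  qed
  show ?thesis
  proof (intro fou_moments.intro fou_moments_axioms.intro)
    show "prob_space M" by fact
    show "integrable M (\<lambda>\<omega>. (\<Sum>p\<in>J. c p * X (fst p) (snd p) \<omega>) ^ 4) \<and>
      expectation (\<lambda>\<omega>. (\<Sum>p\<in>J. c p * X (fst p) (snd p) \<omega>) ^ 4) =
        3 * (expectation (\<lambda>\<omega>. (\<Sum>p\<in>J. c p * X (fst p) (snd p) \<omega>)\<^sup>2))\<^sup>2"
      if J: "finite J" for J :: "(bool \<times> real) set" and c
    proof -
      define \<iota> where "\<iota> p = (component (fst p), snd p)" for p :: "bool \<times> real"
      \<comment> \<open>The inverse of the relabelling, used to carry the coefficients over to the
        new index set.\<close>
      define \<pi> where "\<pi> p = (fst p = 1, snd p)" for p :: "nat \<times> real"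
      have \<iota>: "inj \<iota>" by (auto simp: \<iota>_def inj_on_def prod_eq_iff)
      have \<pi>\<iota>: "\<pi> (\<iota> p) = p" for p
        by (cases "fst p") (auto simp: \<pi>_def \<iota>_def prod_eq_iff)
      let ?S = "\<lambda>\<omega>. \<Sum>p\<in>J. c p * X (fst p) (snd p) \<omega>"
      let ?T = "\<lambda>\<omega>. \<Sum>q\<in>\<iota> ` J. c (\<pi> q) * (case q of (i, t) \<Rightarrow> B i t) \<omega>"
      have "\<iota> ` J \<subseteq> {1, 2} \<times> UNIV" by (auto simp: \<iota>_def component_def)
      then have T: "centered_gaussian M ?T"
        using J
        by (intro gauss[unfolded centered_gaussian_process_def, rule_format, of "\<iota> ` J" "\<lambda>q. c (\<pi> q)"]) simp_all
      then have [measurable]: "?T \<in> borel_measurable M"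
        by (simp add: centered_gaussian_def)
      have "AE \<omega> in M. \<forall>b t. X b t \<omega> = B (component b) t \<omega>"
        using X_B[of True] X_B[of False] by eventually_elim (auto simp: all_bool_eq)
      then have ST: "AE \<omega> in M. ?S \<omega> = ?T \<omega>"
      proof eventually_elim
        case (elim \<omega>)
        then show ?case
          by (subst sum.reindex) (auto intro!: sum.cong inj_on_subset[OF \<iota>] simp: \<pi>\<iota>, simp add: \<iota>_def)
      qed
      have "integrable M (\<lambda>\<omega>. ?S \<omega> ^ 4) \<longleftrightarrow> integrable M (\<lambda>\<omega>. ?T \<omega> ^ 4)"
        using ST by (intro integrable_cong_AE) (auto elim: eventually_mono)
      moreover have "expectation (\<lambda>\<omega>. ?S \<omega> ^ n) = expectation (\<lambda>\<omega>. ?T \<omega> ^ n)" for n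
        using ST by (intro integral_cong_AE) (auto elim: eventually_mono)
      ultimately show ?thesis
        using centered_gaussian_fourth_moment[OF T] by simp
    qed
    show "expectation (\<lambda>\<omega>. X b t \<omega> * X c s \<omega>) =
      (((if b = c then 1 else \<rho>) + sign_rc t * (if b = c then 0 else \<eta> (component b) (component c))) * \<bar>t\<bar> powr (h (component b) + h (component c))
       + ((if b = c then 1 else \<rho>) - sign_rc s * (if b = c then 0 else \<eta> (component b) (component c))) * \<bar>s\<bar> powr (h (component b) + h (component c))
       - ((if b = c then 1 else \<rho>) - sign_rc (s - t) * (if b = c then 0 else \<eta> (component b) (component c))) * \<bar>s - t\<bar> powr (h (component b) + h (component c))) / 2"
      for b c t s
    proof -
      have "expectation (\<lambda>\<omega>. X b t \<omega> * X c s \<omega>) = expectation (\<lambda>\<omega>. B (component b) t \<omega> * B (component c) s \<omega>)"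
      proof (rule integral_cong_AE)
        show "AE \<omega> in M. X b t \<omega> * X c s \<omega> = B (component b) t \<omega> * B (component c) s \<omega>"
          using X_B[of b] X_B[of c] by eventually_elim simp
      qed measurable
      also have "\<dots> = (((if b = c then 1 else \<rho>) + sign_rc t * (if b = c then 0 else \<eta> (component b) (component c))) * \<bar>t\<bar> powr (h (component b) + h (component c))
       + ((if b = c then 1 else \<rho>) - sign_rc s * (if b = c then 0 else \<eta> (component b) (component c))) * \<bar>s\<bar> powr (h (component b) + h (component c))
       - ((if b = c then 1 else \<rho>) - sign_rc (s - t) * (if b = c then 0 else \<eta> (component b) (component c))) * \<bar>s - t\<bar> powr (h (component b) + h (component c))) / 2"
      proof (cases "b = c")
        case True
        have "fractional_brownian_motion M (h (component b)) (B (component b))" "variance (B (component b) 1) = 1"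
          using B component_simps(3)[of b] unfolding bivariate_fbm_def by blast+
        then show ?thesis
          using True by (simp add: fractional_brownian_motion_def)
      next
        case False
        then have hh: "h 1 + h 2 = h (component b) + h (component c)"
          by (cases b; cases c) auto
        have "\<forall>i\<in>{1, 2}. \<forall>j\<in>{1, 2}. i \<noteq> j \<longrightarrow> (\<forall>t s.
            (\<integral>\<omega>. B i t \<omega> * B j s \<omega> \<partial>M) =
              1 / 2 * ((\<rho> + sign_rc t * \<eta> i j) * \<bar>t\<bar> powr (h 1 + h 2)
                + (\<rho> - sign_rc s * \<eta> i j) * \<bar>s\<bar> powr (h 1 + h 2)
                - (\<rho> - sign_rc (s - t) * \<eta> i j) * \<bar>s - t\<bar> powr (h 1 + h 2)))"
          using B unfolding bivariate_fbm_def by (elim conjE)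
        note this[rule_format, OF component_simps(3)[of b] component_simps(3)[of c], unfolded hh]
        then show ?thesis using False by simp
      qed
      finally show ?thesis .
    qed
  qed (use h \<alpha> X_cont in auto)
qed

section \<open>Recovering the parameters from three limiting covariances\<close>

lemma (in fou_moments) C_flip: "C i j (- d) = C j i d"
  using expectation_Z_Z[of i d j 0] expectation_Z_Z[of j 0 i d] by (simp add: mult.commute)

text \<open>Here n stands for \<nu>_1 \<nu>_2, K for H (H - 1), and c0, P, Q for the
  cross-covariance of Z at 0, - s and s. Dividing the two relations by K I12 and K I21 isolates
  (\<rho> + \<eta>)/2 and (\<rho> - \<eta>)/2: their sum yields the coefficients a_i, their
  difference the b_i.\<close>

lemma estimator_coefficients:
  fixes \<rho> \<eta> n K I12 I21 e1 e2 c0 P Q :: real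
  assumes "n \<noteq> 0" "K \<noteq> 0" "I12 \<noteq> 0" "I21 \<noteq> 0"
    and P: "e1 * P - c0 = (\<rho> + \<eta>) / 2 * (K * I12)"
    and Q: "e2 * Q - c0 = (\<rho> - \<eta>) / 2 * (K * I21)"
  shows "n * (- (I12 + I21) / (n * K * I12 * I21) * c0 + e1 / (n * K * I12) * P + e2 / (n * K * I21) * Q) = \<rho>"
    and "n * ((I12 - I21) / (n * K * I12 * I21) * c0 + e1 / (n * K * I12) * P + - (e2 / (n * K * I21)) * Q) = \<eta>"
proof -
  have 1: "e1 / (n * K * I12) * P = (c0 / (K * I12) + (\<rho> + \<eta>) / 2) / n"
  proof -
    have "e1 / (n * K * I12) * P = e1 * P / (n * K * I12)" by simp
    also have "e1 * P = c0 + (\<rho> + \<eta>) / 2 * (K * I12)" using P by linarith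
    finally show ?thesis using assms(1-4) by (simp add: field_simps)
  qed
  have 2: "e2 / (n * K * I21) * Q = (c0 / (K * I21) + (\<rho> - \<eta>) / 2) / n"
  proof -
    have "e2 / (n * K * I21) * Q = e2 * Q / (n * K * I21)" by simp
    also have "e2 * Q = c0 + (\<rho> - \<eta>) / 2 * (K * I21)" using Q by linarith
    finally show ?thesis using assms(1-4) by (simp add: field_simps)
  qed
  show "n * (- (I12 + I21) / (n * K * I12 * I21) * c0 + e1 / (n * K * I12) * P + e2 / (n * K * I21) * Q) = \<rho>"
    unfolding 1 2 using assms(1-4) by (simp add: field_simps)
  show "n * ((I12 - I21) / (n * K * I12 * I21) * c0 + e1 / (n * K * I12) * P + - (e2 / (n * K * I21)) * Q) = \<eta>"
    unfolding mult_minus_left 1 2 using assms(1-4) by (simp add: field_simps)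
qed

theorem theorem6p1p6:
  fixes M :: "'a measure"
    and h \<alpha> \<nu> :: "nat \<Rightarrow> real"
    and H \<rho> :: real
    and \<eta> :: "nat \<Rightarrow> nat \<Rightarrow> real"
    and B Y :: "nat \<Rightarrow> real \<Rightarrow> 'a \<Rightarrow> real"
    and s :: nat
  assumes "prob_space M"
    and "h 1 \<in> {0<..<1} - {1 / 2}"
    and "h 2 \<in> {0<..<1} - {1 / 2}"
    and "H = h 1 + h 2"
    and "H \<noteq> 1"
    and "\<alpha> 1 > 0" and "\<alpha> 2 > 0" and "\<nu> 1 > 0" and "\<nu> 2 > 0"
    and "bivariate_fbm M h \<rho> \<eta> B"
    and "bivariate_fou M \<alpha> \<nu> B Y"
    and "s \<ge> 1"
  shows "converges_L2 M (rho_hat H \<alpha> \<nu> s Y) (\<lambda>_. \<rho>) \<and>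
         converges_L2 M (eta_hat H \<alpha> \<nu> s Y) (\<lambda>_. \<eta> 1 2) \<and>
         converges_in_prob M (rho_hat H \<alpha> \<nu> s Y) (\<lambda>_. \<rho>) \<and>
         converges_in_prob M (eta_hat H \<alpha> \<nu> s Y) (\<lambda>_. \<eta> 1 2)"
proof -
  note fbm = assms(10) and fou = assms(11)
  have h: "h (component b) \<in> {0<..<1}" and \<alpha>: "\<alpha> (component b) > 0" and \<nu>: "\<nu> (component b) > 0" for b
    using assms by (cases b; auto)+
  have "\<forall>b. \<exists>X. (\<forall>t. X t \<in> borel_measurable M) \<and> (\<forall>\<omega>. continuous_on UNIV (\<lambda>t. X t \<omega>)) \<and>
      (AE \<omega> in M. \<forall>t. X t \<omega> = B (component b) t \<omega>)"
  proof
    fix b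
    have f: "fractional_brownian_motion M (h (component b)) (B (component b))"
      using fbm component_simps(3)[of b] unfolding bivariate_fbm_def by blast
    have m: "B (component b) t \<in> borel_measurable M" for t
    proof -
      have "centered_gaussian_process M UNIV (B (component b))"
        using f by (simp add: fractional_brownian_motion_def)
      from this[unfolded centered_gaussian_process_def, rule_format, of "{t}" "\<lambda>_. 1"]
      show ?thesis by (simp add: centered_gaussian_def)
    qed
    have "AE \<omega> in M. continuous_on UNIV (\<lambda>t. B (component b) t \<omega>)"
      using f by (simp add: fractional_brownian_motion_def)
    from continuous_version[OF m this] obtain X where "\<And>t. X t \<in> borel_measurable M"
      "\<And>\<omega>. continuous_on UNIV (\<lambda>t. X t \<omega>)" "AE \<omega> in M. \<forall>t. X t \<omega> = B (component b) t \<omega>"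
      by blast
    then show "\<exists>X. (\<forall>t. X t \<in> borel_measurable M) \<and> (\<forall>\<omega>. continuous_on UNIV (\<lambda>t. X t \<omega>)) \<and>
        (AE \<omega> in M. \<forall>t. X t \<omega> = B (component b) t \<omega>)"
      by (intro exI[of _ X] conjI allI)
  qed
  from choice[OF this] obtain X where X: "\<And>b t. X b t \<in> borel_measurable M"
      "\<And>b \<omega>. continuous_on UNIV (\<lambda>t. X b t \<omega>)"
      "\<And>b. AE \<omega> in M. \<forall>t. X b t \<omega> = B (component b) t \<omega>"
    by blast
  interpret fou_moments M X "\<lambda>b. h (component b)" "\<lambda>b. \<alpha> (component b)"
    "\<lambda>b c. if b = c then 1 else \<rho>" "\<lambda>b c. if b = c then 0 else \<eta> (component b) (component c)"
    by (rule bivariate_fbm_fou_moments[where B = B]) (fact assms(1) h \<alpha> fbm X)+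
  have Y_meas: "Y (component b) t \<in> borel_measurable M" for b t
    using fou component_simps(3)[of b] unfolding bivariate_fou_def by blast
  then have [measurable]: "Y 1 t \<in> borel_measurable M" "Y 2 t \<in> borel_measurable M" for t
    using component_simps(1,2) by metis+
  have Y_Z: "AE \<omega> in M. Y (component b) t \<omega> = \<nu> (component b) * Z b t \<omega>" for b t
  proof -
    have "AE \<omega> in M. \<forall>t. \<exists>I.
        has_rs_integral_atMost (\<lambda>u. exp (- \<alpha> (component b) * (t - u))) (\<lambda>u. B (component b) u \<omega>) t I \<and>
        Y (component b) t \<omega> = \<nu> (component b) * I"
      using fou component_simps(3)[of b] unfolding bivariate_fou_def by blast
    with X(3)[of b] have "AE \<omega> in M. has_rs_integral_atMost (\<lambda>u. exp (- \<alpha> (component b) * (t - u)))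
        (\<lambda>u. X b u \<omega>) t (Y (component b) t \<omega> / \<nu> (component b))"
    proof eventually_elim
      case (elim \<omega>)
      then obtain I where "has_rs_integral_atMost (\<lambda>u. exp (- \<alpha> (component b) * (t - u))) (\<lambda>u. B (component b) u \<omega>) t I"
        "Y (component b) t \<omega> = \<nu> (component b) * I" by blast
      then show ?case using elim(1) \<nu>[of b] by simp
    qed
    from fou_eq_Z[OF this] show ?thesis
      by eventually_elim (use \<nu>[of b] in \<open>auto simp: field_simps\<close>)
  qed
  define c where "c = C True False"
  \<comment> \<open>Both estimators are instances of one linear combination, so its limit is found
    for arbitrary coefficients.\<close>
  have estimator: "converges_L2 M (\<lambda>n \<omega>.
        k1 / real n * (\<Sum>j=1..n. Y 1 (real j) \<omega> * Y 2 (real j) \<omega>)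
      + k2 / real n * (\<Sum>j=1..n - s. Y 1 (real (j + s)) \<omega> * Y 2 (real j) \<omega>)
      + k3 / real n * (\<Sum>j=1..n - s. Y 1 (real j) \<omega> * Y 2 (real (j + s)) \<omega>))
      (\<lambda>_. \<nu> 1 * \<nu> 2 * (k1 * c 0 + k2 * c (- real s) + k3 * c (real s)))" for k1 k2 k3
  proof -
    let ?W = "\<lambda>l p q n \<omega>. 1 / real n * (\<Sum>k=1..n - l. Z True (real (k + p)) \<omega> * Z False (real (k + q)) \<omega>)"
    have W: "converges_L2 M (?W l p q) (\<lambda>_. c (real q - real p))" for l p q
      unfolding c_def by (rule converges_L2_lagged)
    have "converges_L2 M (\<lambda>n \<omega>. \<nu> 1 * \<nu> 2 * (k1 * ?W 0 0 0 n \<omega> + k2 * ?W s s 0 n \<omega> + k3 * ?W s 0 s n \<omega>))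
      (\<lambda>_. \<nu> 1 * \<nu> 2 * (k1 * c (real 0 - real 0) + k2 * c (real 0 - real s) + k3 * c (real s - real 0)))"
      by (intro converges_L2_cmult converges_L2_add W assms(1))
    then have "converges_L2 M (\<lambda>n \<omega>. \<nu> 1 * \<nu> 2 * (k1 * ?W 0 0 0 n \<omega> + k2 * ?W s s 0 n \<omega> + k3 * ?W s 0 s n \<omega>))
      (\<lambda>_. \<nu> 1 * \<nu> 2 * (k1 * c 0 + k2 * c (- real s) + k3 * c (real s)))"
      by simp
    then show ?thesis
    proof (rule converges_L2_cong[rotated 2])
      fix n
      \<comment> \<open>The exceptional set in \<open>Y_Z\<close> depends on the time; a common one
        exists because only integer times are sampled.\<close>
      have "AE \<omega> in M. \<forall>m :: nat. Y 1 (real m) \<omega> = \<nu> 1 * Z True (real m) \<omega> \<and> Y 2 (real m) \<omega> = \<nu> 2 * Z False (real m) \<omega>"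
        unfolding AE_all_countable using Y_Z[of True] Y_Z[of False] by simp
      then show "AE \<omega> in M.
          k1 / real n * (\<Sum>j=1..n. Y 1 (real j) \<omega> * Y 2 (real j) \<omega>)
        + k2 / real n * (\<Sum>j=1..n - s. Y 1 (real (j + s)) \<omega> * Y 2 (real j) \<omega>)
        + k3 / real n * (\<Sum>j=1..n - s. Y 1 (real j) \<omega> * Y 2 (real (j + s)) \<omega>)
        = \<nu> 1 * \<nu> 2 * (k1 * ?W 0 0 0 n \<omega> + k2 * ?W s s 0 n \<omega> + k3 * ?W s 0 s n \<omega>)"
      proof eventually_elim
        case (elim \<omega>)
        have "Y 1 (real p) \<omega> * Y 2 (real q) \<omega> = \<nu> 1 * \<nu> 2 * (Z True (real p) \<omega> * Z False (real q) \<omega>)" for p q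
          using elim by simp
        then show ?case
          unfolding sum_distrib_left[symmetric] by (simp only: sum_distrib_left[symmetric] add_0_right diff_zero) (simp add: algebra_simps)
      qed
    qed measurable
  qed
  have H: "H \<noteq> 0" "H \<noteq> 1" and s: "real s > 0"
    using assms by auto
  have hH: "h (component True) + h (component False) \<noteq> 1" "h (component False) + h (component True) \<noteq> 1"
    using assms(4,5) by simp_all
  note lag = lagged_covariance[OF s hH(1)] lagged_covariance[OF s hH(2)]
  have lag12: "exp (\<alpha> 1 * real s) * c (- real s) - c 0 = (\<rho> + \<eta> 1 2) / 2 * (H * (H - 1) * I_coef H \<alpha> 1 2 s)"
    and I12: "I_coef H \<alpha> 1 2 s > 0"
    using lag(1,2) by (simp_all add: c_def I_coef_def assms(4))
  \<comment> \<open>The term \<open>- 0\<close> is left unsimplified so that \<open>C_flip\<close>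
    rewrites both covariances; antisymmetry of \<eta> then turns \<eta>_21 into -\<eta>_12.\<close>
  have "exp (\<alpha> 2 * real s) * C False True (- real s) - C False True (- 0)
      = (\<rho> + \<eta> 2 1) / 2 * (H * (H - 1) * I_coef H \<alpha> 2 1 s)"
    and I21: "I_coef H \<alpha> 2 1 s > 0"
    using lag(3,4) by (simp_all add: I_coef_def assms(4) add.commute)
  then have lag21: "exp (\<alpha> 2 * real s) * c (real s) - c 0 = (\<rho> - \<eta> 1 2) / 2 * (H * (H - 1) * I_coef H \<alpha> 2 1 s)"
    using fbm unfolding C_flip bivariate_fbm_def c_def by simp
  have \<nu>0: "\<nu> 1 * \<nu> 2 \<noteq> 0" and H0: "H * (H - 1) \<noteq> 0" using assms(8,9) H by auto
  have I0: "I_coef H \<alpha> 1 2 s \<noteq> 0" "I_coef H \<alpha> 2 1 s \<noteq> 0" using I12 I21 by auto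
  note limit_val = estimator_coefficients[OF \<nu>0 H0 I0 lag12 lag21]
  have \<rho>: "converges_L2 M (rho_hat H \<alpha> \<nu> s Y) (\<lambda>_. \<rho>)"
    using estimator[of "a1 H \<alpha> \<nu> s" "a2 H \<alpha> \<nu> s" "a3 H \<alpha> \<nu> s"] limit_val(1)
    by (simp add: rho_hat_def[abs_def] a1_def a2_def a3_def mult.assoc)
  have \<eta>: "converges_L2 M (eta_hat H \<alpha> \<nu> s Y) (\<lambda>_. \<eta> 1 2)"
    using estimator[of "b1 H \<alpha> \<nu> s" "b2 H \<alpha> \<nu> s" "b3 H \<alpha> \<nu> s"] limit_val(2)
    by (simp add: eta_hat_def[abs_def] b1_def b2_def b3_def a2_def a3_def mult.assoc)
  show ?thesis
    using \<rho> \<eta> converges_L2_imp_in_prob[OF assms(1)] by simp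
qed

end
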